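(* Let $D$ be a locally in-semicomplete digraph, a locally out-semicomplete digraph, or a locally semicomplete digraph. Then $D$ is a KP-digraph if and only if $D$ has no induced subdigraph $H$ such that $H$ is a directed odd cycle, $H\cong \overrightarrow{C}_7(1,2)$, or $H\cong \overrightarrow{C}_n(1,\pm2,\pm3,\dots,\pm\lfloor \frac{n}{2}\rfloor)$ for some $n\ge4$.
   Context: Digraphs are finite, without loops or parallel arcs; both arcs $uv$ and $vu$ may be present. A digraph is semicomplete if every two distinct vertices are joined by at least one arc. $D$ is locally in-semicomplete (resp. locally out-semicomplete) if for every vertex $v$ the in-neighbourhood $N^-(v)$ (resp. out-neighbourhood $N^+(v)$) induces a semicomplete subdigraph; locally semicomplete means both. A kernel is a set $S$ of vertices that is independent (no arc between two vertices of $S$) and absorbent (every vertex outside $S$ has an arc into $S$). $D$ is a KP-digraph if $D$ and every induced subdigraph of $D$ have a kernel. For nonempty $J\subseteq\mathbb{Z}_m\setminus\{0\}$, $\overrightarrow{C}_m(J)$ has vertex set $\mathbb{Z}_m$ and arcs $(i,j)$ with $j-i\in J$; $\overrightarrow{C}_7(1,2)$ has $J=\{1,2\}$ and $\overrightarrow{C}_n(1,\pm2,\dots,\pm\lfloor n/2\rfloor)$ has $J=\{1\}\cup\{\pm k:2\le k\le\lfloor n/2\rfloor\}$. *)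

theory Defs
  imports "Graph_Theory.Graph_Theory" "HOL-Number_Theory.Cong"
begin

definition in_neighbourhood :: "('a,'b) pre_digraph \<Rightarrow> 'a \<Rightarrow> 'a set" where
  "in_neighbourhood D v = {u. u \<rightarrow>\<^bsub>D\<^esub> v}"

definition out_neighbourhood :: "('a,'b) pre_digraph \<Rightarrow> 'a \<Rightarrow> 'a set" where
  "out_neighbourhood D v = {u. v \<rightarrow>\<^bsub>D\<^esub> u}"

definition semicomplete :: "('a,'b) pre_digraph \<Rightarrow> bool" where
  "semicomplete D \<longleftrightarrow>
     (\<forall>u \<in> verts D. \<forall>v \<in> verts D. u \<noteq> v \<longrightarrow> u \<rightarrow>\<^bsub>D\<^esub> v \<or> v \<rightarrow>\<^bsub>D\<^esub> u)"

definition locally_in_semicomplete :: "('a,'b) pre_digraph \<Rightarrow> bool" where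
  "locally_in_semicomplete D \<longleftrightarrow> (\<forall>v \<in> verts D. semicomplete (D \<restriction> in_neighbourhood D v))"

definition locally_out_semicomplete :: "('a,'b) pre_digraph \<Rightarrow> bool" where
  "locally_out_semicomplete D \<longleftrightarrow> (\<forall>v \<in> verts D. semicomplete (D \<restriction> out_neighbourhood D v))"

definition locally_semicomplete :: "('a,'b) pre_digraph \<Rightarrow> bool" where
  "locally_semicomplete D \<longleftrightarrow> locally_in_semicomplete D \<and> locally_out_semicomplete D"

definition independent :: "('a,'b) pre_digraph \<Rightarrow> 'a set \<Rightarrow> bool" where
  "independent D S \<longleftrightarrow> (\<forall>u \<in> S. \<forall>v \<in> S. \<not> u \<rightarrow>\<^bsub>D\<^esub> v)"

definition absorbent :: "('a,'b) pre_digraph \<Rightarrow> 'a set \<Rightarrow> bool" where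
  "absorbent D S \<longleftrightarrow> (\<forall>u \<in> verts D - S. \<exists>v \<in> S. u \<rightarrow>\<^bsub>D\<^esub> v)"

definition kernel :: "('a,'b) pre_digraph \<Rightarrow> 'a set \<Rightarrow> bool" where
  "kernel D S \<longleftrightarrow> S \<subseteq> verts D \<and> independent D S \<and> absorbent D S"

text \<open>
  The null digraph counts as an induced subdigraph; this is harmless, since the empty set is
  its kernel.
\<close>

definition KP_digraph :: "('a,'b) pre_digraph \<Rightarrow> bool" where
  "KP_digraph D \<longleftrightarrow>
     (\<exists>S. kernel D S) \<and> (\<forall>H. induced_subgraph H D \<longrightarrow> (\<exists>S. kernel H S))"

text \<open>
  The whole digraph is traversed by a single directed cycle with an odd number of arcs. In a
  loopfree digraph such a cycle has length at least 3.
\<close>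

definition directed_odd_cycle :: "('a,'b) pre_digraph \<Rightarrow> bool" where
  "directed_odd_cycle H \<longleftrightarrow>
     (\<exists>p. pre_digraph.cycle H p \<and> odd (length p) \<and>
          arcs H = set p \<and> verts H = tail H ` set p)"

text \<open>
  The residues modulo \<open>m\<close> are represented by \<open>0, \<dots>, m - 1\<close>. The connection set \<open>J\<close> consists of
  integers read modulo \<open>m\<close>, so that negative and congruent representatives are allowed; none of
  them should be divisible by \<open>m\<close>.
\<close>

definition circulant :: "nat \<Rightarrow> int set \<Rightarrow> int pair_pre_digraph" where
  "circulant m J =
     \<lparr> pverts = {0..<int m},
       parcs = {(i, j). i \<in> {0..<int m} \<and> j \<in> {0..<int m} \<and>
                        (\<exists>k \<in> J. [j - i = k] (mod int m))} \<rparr>"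

text \<open>\<open>J = {1, \<plusminus>2, \<dots>, \<plusminus>\<lfloor>n/2\<rfloor>}\<close>\<close>

definition one_pm_jumps :: "nat \<Rightarrow> int set" where
  "one_pm_jumps n =
     {1} \<union> (\<Union>k \<in> {2..\<lfloor>real n / 2\<rfloor>}. {k, - k})"

end

theory Submission
  imports Defs "HOL-Combinatorics.Cycles" "Jordan_Normal_Form.Determinant"
begin

text \<open>
  The forbidden digraphs have no kernel. Conversely, let \<open>W\<close> be a minimal vertex set inducing a
  subdigraph without kernel, and for \<open>v \<in> W\<close> let \<open>K v\<close> be a kernel of the subdigraph induced by
  \<open>W - {v}\<close>. In the in-semicomplete case, \<open>v\<close> has a unique in-neighbour \<open>prev v\<close> in \<open>K v\<close>, and
  comparing the kernels \<open>K u\<close> and \<open>K v\<close> on their symmetric difference shows that \<open>prev\<close> is a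
  permutation with \<open>K (prev v) = prev ` K v\<close>. Along an orbit of \<open>prev\<close>, the vertices absorbed by
  an element of \<open>K u\<close> form an interval, so the orbit induces a circulant \<open>C_n(1, \<dots>, r)\<close> with
  \<open>n = (r + 1) m + 1\<close>; this has no kernel, so it is all of \<open>W\<close> by minimality. In the
  out-semicomplete case, let \<open>A\<close> be the matrix of closed out-neighbourhoods and \<open>K\<close> the incidence
  matrix of the kernels. Then \<open>AK = J - I\<close>, which forces \<open>KA = J - I\<close>; hence the sets
  \<open>{u. i \<in> K u}\<close> play the role of the kernels in the converse digraph, which is in-semicomplete.
  Finally, unless \<open>r = 1\<close>, \<open>m = 1\<close> or \<open>r = m = 2\<close>, the circulant properly contains an induced odd
  cycle.
\<close>

section \<open>Systems of kernels of vertex-deleted subdigraphs\<close>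

text \<open>The vertices in \<open>W\<close> form the circulant on the residues modulo
  \<open>n\<close> with jumps 1, ..., \<open>r\<close>. Labels are all integers, taken periodically,
  so that they can be shifted and negated without reduction.\<close>

definition circular :: "('a \<Rightarrow> 'a \<Rightarrow> bool) \<Rightarrow> 'a set \<Rightarrow> nat \<Rightarrow> nat \<Rightarrow> (int \<Rightarrow> 'a) \<Rightarrow> bool" where
  "circular E W n r p \<longleftrightarrow> range p = W \<and> (\<forall>a b. p a = p b \<longleftrightarrow> a mod int n = b mod int n) \<and>
     (\<forall>a b. E (p a) (p b) \<longleftrightarrow> (b - a) mod int n \<in> {1..int r})"

text \<open>The sets \<open>K v\<close> are kernels of the subdigraphs induced by \<open>V - {v}\<close>. Minimality of \<open>V\<close> is
  left out, because it is not available for the converse digraph in the out-semicomplete case.\<close>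

locale kernel_system =
  fixes V :: "'a set" and E :: "'a \<Rightarrow> 'a \<Rightarrow> bool" and K :: "'a \<Rightarrow> 'a set"
  assumes finite_V: "finite V"
    and in_semi: "\<lbrakk>x \<in> V; y \<in> V; z \<in> V; E x z; E y z; x \<noteq> y\<rbrakk> \<Longrightarrow> E x y \<or> E y x"
    and K_sub: "v \<in> V \<Longrightarrow> K v \<subseteq> V - {v}"
    and K_indep: "\<lbrakk>v \<in> V; x \<in> K v; y \<in> K v\<rbrakk> \<Longrightarrow> \<not> E x y"
    and K_absorb: "\<lbrakk>v \<in> V; x \<in> V; x \<noteq> v; x \<notin> K v\<rbrakk> \<Longrightarrow> \<exists>k\<in>K v. E x k"
    and K_no: "\<lbrakk>v \<in> V; k \<in> K v\<rbrakk> \<Longrightarrow> \<not> E v k"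
    and K_in: "v \<in> V \<Longrightarrow> \<exists>k\<in>K v. E k v"
begin

text \<open>The value outside \<open>V\<close> lets \<open>prev\<close> become a permutation of the
  whole type that moves only finitely many points, so that \<open>least_power\<close> measures its
  orbits.\<close>

definition prev :: "'a \<Rightarrow> 'a" where
  "prev v = (if v \<in> V then SOME k. k \<in> K v \<and> E k v else v)"

lemma K_V: "\<lbrakk>v \<in> V; k \<in> K v\<rbrakk> \<Longrightarrow> k \<in> V" and K_neq: "\<lbrakk>v \<in> V; k \<in> K v\<rbrakk> \<Longrightarrow> k \<noteq> v"
  using K_sub by auto

lemma prev_K: "v \<in> V \<Longrightarrow> prev v \<in> K v" and E_prev: "v \<in> V \<Longrightarrow> E (prev v) v"
  using someI_ex[of "\<lambda>k. k \<in> K v \<and> E k v"] K_in[of v] by (auto simp: prev_def)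

lemma prev_V: "v \<in> V \<Longrightarrow> prev v \<in> V"
  using prev_K K_V by blast

lemma prev_neq: "v \<in> V \<Longrightarrow> prev v \<noteq> v"
  using prev_K K_neq by blast

text \<open>Two distinct in-neighbours of \<open>v\<close> in \<open>K v\<close> would be adjacent,
  against the independence of \<open>K v\<close>.\<close>

lemma prev_eqI: "\<lbrakk>v \<in> V; k \<in> K v; E k v\<rbrakk> \<Longrightarrow> k = prev v"
  by (metis E_prev K_V K_indep in_semi prev_K)

text \<open>As in-neighbours of \<open>y\<close>, \<open>b\<close> and \<open>v\<close> are
  adjacent; since \<open>v\<close> has no arc into \<open>K v\<close>, the arc goes from
  \<open>b\<close> to \<open>v\<close>. This identifies the predecessors that an exchange
  produces.\<close>

lemma common_out_prev:
  assumes "v \<in> V" "y \<in> V" "b \<in> K v" "E b y" "E v y"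
  shows "b = prev v"
  using assms in_semi[of b v y] K_V K_neq K_no prev_eqI by metis

text \<open>In the subdigraph induced by the symmetric difference of two of the kernels all in-degrees
  are at most 1, while all out-degrees, with at most two exceptions, are at least 1.\<close>

lemma exchange:
  assumes "u \<in> V" "v \<in> V" "v \<notin> K u"
  defines "B \<equiv> (K u - K v) \<union> (K v - K u)"
  shows "\<exists>g. inj_on g (B - {u}) \<and> g ` (B - {u}) \<subseteq> B \<and> (\<forall>x\<in>B - {u}. E x (g x))"
proof -
  have ex: "\<exists>y\<in>B. E x y" if "x \<in> B - {u}" for x
  proof (cases "x \<in> K u")
    case True
    then have "x \<notin> K v" "x \<noteq> v" "x \<in> V" using that assms K_V unfolding B_def by auto
    then obtain k where "k \<in> K v" "E x k" using K_absorb assms(2) by blast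
    then show ?thesis using True K_indep[OF assms(1)] unfolding B_def by blast
  next
    case False
    then have "x \<in> K v" "x \<noteq> u" "x \<in> V" using that assms K_V unfolding B_def by auto
    then obtain k where "k \<in> K u" "E x k" using K_absorb[OF assms(1)] False by blast
    then show ?thesis using \<open>x \<in> K v\<close> K_indep[OF assms(2)] unfolding B_def by blast
  qed
  define g where "g x = (SOME y. y \<in> B \<and> E x y)" for x
  have g: "g x \<in> B \<and> E x (g x)" if "x \<in> B - {u}" for x
    using someI_ex[of "\<lambda>y. y \<in> B \<and> E x y"] ex[OF that] unfolding g_def by blast
  \<comment> \<open>Two vertices with the same image both lie in the kernel that does not contain
    the image, yet in-semicompleteness makes them adjacent.\<close>
  have "inj_on g (B - {u})"
  proof (rule inj_onI, rule ccontr)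
    fix x y assume xy: "x \<in> B - {u}" "y \<in> B - {u}" "g x = g y" "x \<noteq> y"
    have E: "E x (g x)" "E y (g x)" and gB: "g x \<in> B" using g xy by metis+
    have V: "x \<in> V" "y \<in> V" "g x \<in> V" using xy gB K_V assms unfolding B_def by auto
    have adj: "E x y \<or> E y x" using in_semi[OF V E xy(4)] .
    show False
    proof (cases "g x \<in> K u")
      case True
      then have "x \<in> K v" "y \<in> K v" using E xy K_indep[OF assms(1)] unfolding B_def by blast+
      then show False using adj K_indep[OF assms(2)] by blast
    next
      case False
      then have "x \<in> K u" "y \<in> K u" using E xy K_indep[OF assms(2)] gB unfolding B_def by blast+
      then show False using adj K_indep[OF assms(1)] by blast
    qed
  qed
  then show ?thesis using g by blast
qed

section \<open>Bijectivity of \<open>prev\<close> and its compatibility with the kernels\<close>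

lemma finite_K: "v \<in> V \<Longrightarrow> finite (K v)"
  using K_sub finite_V by (metis Diff_subset finite_subset)

text \<open>With \<open>u\<close> and \<open>v\<close> outside each other's kernels there is no
  exceptional vertex, so the injection of \<open>exchange\<close> maps the finite symmetric
  difference onto itself. The preimage of \<open>y\<close> cannot lie in the independent set
  \<open>K u\<close>.\<close>

lemma exchange_pred:
  assumes "u \<in> V" "v \<in> V" "v \<notin> K u" "u \<notin> K v" "y \<in> K u" "y \<notin> K v"
  obtains b where "b \<in> K v" "b \<notin> K u" "E b y"
proof -
  define B where "B = (K u - K v) \<union> (K v - K u)"
  have Bu: "B - {u} = B" using assms K_neq unfolding B_def by blast
  obtain g where g: "inj_on g B" "g ` B \<subseteq> B" "\<And>x. x \<in> B \<Longrightarrow> E x (g x)"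
    using exchange[OF assms(1-3), folded B_def, unfolded Bu] by blast
  have "finite B" using finite_K assms(1,2) unfolding B_def by simp
  then have "g ` B = B" using endo_inj_surj g by blast
  moreover have "y \<in> B" using assms unfolding B_def by blast
  ultimately obtain b where b: "b \<in> B" "y = g b" by blast
  then have "E b y" using g by blast
  then have "b \<notin> K u" using K_indep[OF assms(1)] assms by blast
  then show thesis using that b \<open>E b y\<close> unfolding B_def by blast
qed

text \<open>A common value \<open>prev u = prev v\<close> dominates both vertices and so keeps each
  out of the other's kernel. Exchange at an absorber of \<open>v\<close> in \<open>K u\<close> then
  yields a predecessor outside \<open>K u\<close>; it must be \<open>prev v\<close>, which equals
  \<open>prev u\<close> and lies in \<open>K u\<close>.\<close>

lemma prev_inj: "inj_on prev V"
proof (rule inj_onI, rule ccontr)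
  fix u v assume *: "u \<in> V" "v \<in> V" "prev u = prev v" "u \<noteq> v"
  have no: "v \<notin> K u" "u \<notin> K v"
    using * prev_K E_prev K_indep by metis+
  obtain k where k: "k \<in> K u" "E v k" using K_absorb * no by metis
  have kv: "k \<notin> K v" using k K_no * by blast
  obtain b where b: "b \<in> K v" "b \<notin> K u" "E b k"
    using exchange_pred[OF *(1,2) no k(1) kv] .
  have "b = prev v" using common_out_prev b k * K_V by blast
  then show False using b * prev_K by metis
qed

lemma prev_surj:
  assumes "u \<in> V"
  obtains w where "w \<in> V" "prev w = u"
proof -
  have "prev ` V = V" by (rule endo_inj_surj[OF finite_V _ prev_inj]) (use prev_V in blast)
  then have "u \<in> prev ` V" using assms by simp
  then show thesis using that by blast
qed

text \<open>Otherwise exchange applies to \<open>v\<close> and \<open>w\<close>: the predecessor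
  found for an absorber of \<open>w\<close> in \<open>K v\<close> lies outside \<open>K v\<close>,
  but it has to be \<open>prev w\<close>.\<close>

lemma K_symmetry:
  assumes "v \<in> V" "w \<in> V" "prev w \<in> K v" "w \<noteq> v"
  shows "v \<in> K w"
proof (rule ccontr)
  assume no: "v \<notin> K w"
  have no': "w \<notin> K v" using assms E_prev K_indep by blast
  obtain k where k: "k \<in> K v" "E w k" using K_absorb assms no' by blast
  have "k \<notin> K w" using k K_no assms by blast
  then obtain b where b: "b \<in> K w" "b \<notin> K v" "E b k"
    using exchange_pred[OF assms(1,2) no' no k(1)] by blast
  then have "b = prev w" using common_out_prev k assms K_V by blast
  then show False using b assms by blast
qed

text \<open>Two uses of \<open>K_symmetry\<close>, by way of \<open>prev b \<in> K a\<close>; the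
  case \<open>a = prev b\<close>, where the first one is not applicable, is immediate.\<close>

lemma K_shift_up:
  assumes "a \<in> V" "b \<in> V" "prev a \<in> K (prev b)"
  shows "a \<in> K b"
proof (cases "a = prev b")
  case True
  then show ?thesis using prev_K[OF assms(2)] by simp
next
  case False
  have "a \<noteq> b" using assms(3) K_neq[OF prev_V[OF assms(2)]] by auto
  have "prev b \<in> K a" using K_symmetry[of "prev b" a] assms prev_V False by blast
  then show ?thesis using K_symmetry[of a b] assms \<open>a \<noteq> b\<close> by blast
qed

text \<open>The converse of \<open>K_shift_up\<close> comes from counting: \<open>S\<close> is
  contained in \<open>R\<close>, while its image under \<open>prev\<close> in both coordinates
  contains \<open>R\<close>, so the two finite sets coincide.\<close>

lemma K_shift:
  assumes "a \<in> V" "b \<in> V"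
  shows "prev a \<in> K (prev b) \<longleftrightarrow> a \<in> K b"
proof -
  define R where "R = {(a, b). a \<in> V \<and> b \<in> V \<and> a \<in> K b}"
  define S where "S = {(a, b). a \<in> V \<and> b \<in> V \<and> prev a \<in> K (prev b)}"
  have fin: "finite R" using finite_V finite_subset[of R "V \<times> V"] unfolding R_def by auto
  have SR: "S \<subseteq> R" using K_shift_up unfolding S_def R_def by auto
  have "R \<subseteq> map_prod prev prev ` S"
  proof
    fix z assume "z \<in> R"
    then obtain a b where z: "z = (a, b)" "a \<in> V" "b \<in> V" "a \<in> K b" unfolding R_def by auto
    then obtain a' b' where "a' \<in> V" "b' \<in> V" "a = prev a'" "b = prev b'" using prev_surj by metis
    then show "z \<in> map_prod prev prev ` S" using z unfolding S_def by auto
  qed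
  then have "card R \<le> card S" using fin SR by (meson card_mono card_image_le finite_imageI finite_subset order_trans)
  then have "S = R" using fin SR card_seteq by blast
  then show ?thesis using assms unfolding S_def R_def by auto
qed

text \<open>An absorber in \<open>K u\<close> can be carried along \<open>prev\<close> until the
  orbit meets \<open>u\<close> or \<open>K u\<close>: the hypotheses force
  \<open>u \<notin> K v\<close>, and the predecessor of \<open>k\<close> supplied by exchange is
  then \<open>prev v\<close>.\<close>

lemma target_prev:
  assumes V: "u \<in> V" "v \<in> V" and v: "v \<notin> K u" "v \<noteq> u" and pv: "prev v \<notin> K u" "prev v \<noteq> u"
    and k: "k \<in> K u" "E v k"
  shows "E (prev v) k"
proof -
  have no: "u \<notin> K v"
  proof
    assume "u \<in> K v"
    obtain w where w: "w \<in> V" "prev w = u" using prev_surj[OF V(1)] by blast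
    have "w \<noteq> v" using w pv by blast
    then have "v \<in> K w" using K_symmetry[of v w] w V \<open>u \<in> K v\<close> by blast
    then have "prev v \<in> K u" using K_shift[of v w] w V by blast
    then show False using pv by blast
  qed
  have "k \<notin> K v" using K_no V k by blast
  then obtain b where b: "b \<in> K v" "E b k"
    using exchange_pred[OF V v(1) no k(1)] by blast
  have "b = prev v" using common_out_prev[OF V(2) _ b k(2)] K_V V k by blast
  then show ?thesis using b by blast
qed

text \<open>Here \<open>u\<close> belongs to the symmetric difference \<open>B\<close> and is the
  only exceptional vertex, so the injection of \<open>exchange\<close> misses just one vertex of
  \<open>B\<close>. Out-neighbours of \<open>y\<close> in \<open>K u\<close> have no predecessor in
  \<open>B\<close>, so all of them are missed.\<close>

lemma target_unique:
  assumes V: "u \<in> V" "y \<in> V" and y: "y \<notin> K u" "y \<noteq> u" and py: "prev y \<in> K u \<or> prev y = u"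
    and k: "k \<in> K u" "E y k" and k': "k' \<in> K u" "E y k'"
  shows "k = k'"
proof (rule ccontr)
  assume neq: "k \<noteq> k'"
  have uK: "u \<in> K y" using py prev_K K_symmetry[of u y] V y by metis
  define B where "B = (K u - K y) \<union> (K y - K u)"
  obtain g where g: "inj_on g (B - {u})" "g ` (B - {u}) \<subseteq> B" "\<And>x. x \<in> B - {u} \<Longrightarrow> E x (g x)"
    using exchange[OF V y(1), folded B_def] by blast
  have fin: "finite B" using finite_K V unfolding B_def by blast
  have source: "\<not> E b k" if "k \<in> K u" "E y k" "b \<in> B" for b k
  proof
    assume "E b k"
    then have "b \<in> K y" using that K_indep V unfolding B_def by blast
    then have "b = prev y" using common_out_prev \<open>E b k\<close> that V K_V by blast
    then show False using py \<open>E b k\<close> that K_indep K_no V by metis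
  qed
  have "g ` (B - {u}) \<subseteq> B - {k, k'}" using g source k k' by blast
  then have "card (B - {u}) \<le> card (B - {k, k'})"
    using g(1) fin by (metis card_image card_mono finite_Diff)
  moreover have kB: "{k, k'} \<subseteq> B" "u \<in> B" using k k' K_no V uK K_neq unfolding B_def by blast+
  ultimately show False using fin neq card_mono[OF fin kB(1)] by (simp add: card_Diff_subset)
qed

section \<open>Orbits of \<open>prev\<close> and the arcs within them\<close>

lemma prev_permutation: "permutation prev"
proof -
  have "prev permutes V"
  proof (rule bij_imp_permutes)
    show "bij_betw prev V V"
      unfolding bij_betw_def using prev_inj prev_V prev_surj by (metis image_iff subset_antisym subsetI)
    show "\<And>x. x \<notin> V \<Longrightarrow> prev x = x" unfolding prev_def by simp
  qed
  then show ?thesis using finite_V permutation_permutes by blast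
qed

lemma prev_pow_V: "u \<in> V \<Longrightarrow> (prev ^^ i) u \<in> V"
  by (induction i) (auto intro: prev_V)

lemma K_shift_pow: "\<lbrakk>a \<in> V; b \<in> V\<rbrakk> \<Longrightarrow> (prev ^^ i) a \<in> K ((prev ^^ i) b) \<longleftrightarrow> a \<in> K b"
  by (induction i) (auto simp: K_shift prev_pow_V)

lemma prev_pow_inj: "(prev ^^ i) a = (prev ^^ i) b \<longleftrightarrow> a = b"
  using prev_permutation by (metis bij_fn bij_is_inj injD permutation_bijective)

abbreviation period :: "'a \<Rightarrow> nat" where
  "period \<equiv> least_power prev"

lemma period: "(prev ^^ i) u = u \<longleftrightarrow> period u dvd i" "period u > 0"
  using least_power_dvd[OF prev_permutation] least_power_of_permutation(2)[OF prev_permutation]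
  by auto

lemma prev_pow_commute: "(prev ^^ i) ((prev ^^ j) u) = (prev ^^ (i + j)) u"
  by (simp add: funpow_add)

lemma period_pow: "period ((prev ^^ i) u) = period u"
proof -
  have "(prev ^^ n) ((prev ^^ i) u) = (prev ^^ i) u \<longleftrightarrow> (prev ^^ n) u = u" for n
    by (metis prev_pow_commute prev_pow_inj add.commute)
  then show ?thesis unfolding least_power_def by simp
qed

text \<open>For \<open>u \<in> V\<close>, the second positive time at which the orbit meets
  \<open>u\<close> or \<open>K u\<close>; the first is 1, because \<open>prev u\<close> lies in
  \<open>K u\<close>. The largest jump of the resulting circulant is
  \<open>next_hit u - 2\<close>.\<close>

definition next_hit :: "'a \<Rightarrow> nat" where
  "next_hit u = (LEAST t. 1 < t \<and> ((prev ^^ t) u \<in> K u \<or> (prev ^^ t) u = u))"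

lemma next_hit_pow:
  assumes "u \<in> V"
  shows "next_hit ((prev ^^ i) u) = next_hit u"
proof -
  have "(prev ^^ t) ((prev ^^ i) u) \<in> K ((prev ^^ i) u) \<longleftrightarrow> (prev ^^ t) u \<in> K u" for t
    using K_shift_pow[of "(prev ^^ t) u" u i] assms prev_pow_V by (metis prev_pow_commute add.commute)
  moreover have "(prev ^^ t) ((prev ^^ i) u) = (prev ^^ i) u \<longleftrightarrow> (prev ^^ t) u = u" for t
    by (metis prev_pow_commute prev_pow_inj add.commute)
  ultimately show ?thesis unfolding next_hit_def by simp
qed

lemma period_gt_1: "u \<in> V \<Longrightarrow> period u > 1"
  using period(1)[of 1 u] period(2)[of u] prev_neq by (cases "period u = 1") auto

lemma next_hit:
  assumes "u \<in> V"
  shows "2 < next_hit u" "next_hit u \<le> period u"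
    "(prev ^^ next_hit u) u \<in> K u \<or> (prev ^^ next_hit u) u = u"
    "\<lbrakk>1 < t; t < next_hit u\<rbrakk> \<Longrightarrow> (prev ^^ t) u \<notin> K u \<and> (prev ^^ t) u \<noteq> u"
proof -
  let ?P = "\<lambda>t. 1 < t \<and> ((prev ^^ t) u \<in> K u \<or> (prev ^^ t) u = u)"
  have P: "?P (period u)" using period(1)[of "period u" u] period_gt_1[OF assms] by simp
  have hit: "?P (next_hit u)" unfolding next_hit_def by (rule LeastI[of ?P "period u", OF P])
  show "next_hit u \<le> period u" unfolding next_hit_def by (rule Least_le[of ?P "period u", OF P])
  show "(prev ^^ next_hit u) u \<in> K u \<or> (prev ^^ next_hit u) u = u" using hit by blast
  show "(prev ^^ t) u \<notin> K u \<and> (prev ^^ t) u \<noteq> u" if "1 < t" "t < next_hit u" for t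
    using not_less_Least[of t ?P] that unfolding next_hit_def by blast
  \<comment> \<open>Time 2 is no hit, since the vertex there dominates
    \<open>prev u \<in> K u\<close>. This makes the largest jump at least 1.\<close>
  have "E (prev (prev u)) (prev u)" using E_prev prev_V assms by blast
  then have "prev (prev u) \<notin> K u" "prev (prev u) \<noteq> u"
    using K_indep[OF assms] K_no[OF assms] prev_K[OF assms] by metis+
  then have "next_hit u \<noteq> 2" using hit by (auto simp: numeral_2_eq_2)
  then show "2 < next_hit u" using hit by linarith
qed

lemma target_range:
  assumes u: "u \<in> V" and k: "k \<in> K u" "E ((prev ^^ i) u) k" and ij: "i \<le> j"
    and out: "\<And>t. \<lbrakk>i \<le> t; t \<le> j\<rbrakk> \<Longrightarrow> (prev ^^ t) u \<notin> K u \<and> (prev ^^ t) u \<noteq> u"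
  shows "E ((prev ^^ j) u) k"
  using ij out
proof (induction j rule: dec_induct)
  case base
  then show ?case using k by simp
next
  case (step l)
  have "E ((prev ^^ l) u) k" using step by simp
  then show ?case
    using target_prev[OF u prev_pow_V[OF u, of l] _ _ _ _ k(1)] step.prems[of l] step.prems[of "Suc l"] step.hyps
    by simp
qed

text \<open>One direction carries the arc from \<open>prev (prev u)\<close> to \<open>prev u\<close>
  along the orbit up to the next hit. Conversely, an arc from beyond \<open>next_hit u\<close> could
  be carried to the end of its gap between two hits, where a vertex would have two absorbers in
  \<open>K u\<close>, against \<open>target_unique\<close>.\<close>

lemma in_arcs_prev:
  assumes u: "u \<in> V" and j: "1 \<le> j" "j \<le> period u"
  shows "E ((prev ^^ j) u) (prev u) \<longleftrightarrow> 2 \<le> j \<and> j < next_hit u"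
proof
  assume jr: "2 \<le> j \<and> j < next_hit u"
  show "E ((prev ^^ j) u) (prev u)"
  proof (rule target_range[of u "prev u" 2 j])
    show "E ((prev ^^ 2) u) (prev u)" using E_prev prev_V u by (simp add: numeral_2_eq_2)
  qed (use u jr prev_K next_hit in auto)
next
  assume E: "E ((prev ^^ j) u) (prev u)"
  let ?c = "\<lambda>i. (prev ^^ i) u"
  let ?H = "\<lambda>t. ?c t \<in> K u \<or> ?c t = u"
  have Hj: "\<not> ?H j" using E K_indep[OF u] K_no[OF u] prev_K[OF u] by metis
  show "2 \<le> j \<and> j < next_hit u"
  proof (rule ccontr)
    assume neg: "\<not> ?thesis"
    have "j \<noteq> 1" using Hj prev_K[OF u] by auto
    then have jr: "next_hit u < j" using neg j Hj next_hit(3)[OF u] by (cases "j = next_hit u") auto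
    \<comment> \<open>The last hit before \<open>j\<close>. It is no earlier than
      \<open>next_hit u\<close>, hence different from time 1.\<close>
    define a where "a = (GREATEST t. t \<le> j \<and> ?H t)"
    have a: "a \<le> j \<and> ?H a" and a_max: "\<And>t. t \<le> j \<Longrightarrow> ?H t \<Longrightarrow> t \<le> a"
      using GreatestI_nat[of "\<lambda>t. t \<le> j \<and> ?H t" "next_hit u" j] jr next_hit(3)[OF u]
        Greatest_le_nat[of "\<lambda>t. t \<le> j \<and> ?H t" _ j] unfolding a_def by auto
    have aj: "a < j" using a Hj by (cases "a = j") auto
    have a1: "1 < a" using a_max[of "next_hit u"] jr next_hit(1,3)[OF u] by simp
    have an: "?c a \<noteq> u" using period(1)[of a u] aj j a1 by (auto dest: dvd_imp_le)
    then have aK: "?c a \<in> K u" using a by blast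
    \<comment> \<open>\<open>Suc b\<close> is the first hit after \<open>j\<close>, so
      \<open>?c b\<close> ends the gap and satisfies the hypothesis of \<open>target_unique\<close>
      on its \<open>prev\<close>. Such a hit exists by time \<open>period u\<close>.\<close>
    define b where "b = (LEAST t. j \<le> t \<and> ?H (Suc t))"
    have "j \<le> period u - 1 \<and> ?H (Suc (period u - 1))"
    proof -
      have "?H (period u)" using period(1)[of "period u" u] by simp
      then show ?thesis using Hj j by (cases "j = period u") auto
    qed
    then have b: "j \<le> b \<and> ?H (Suc b)" and b_min: "\<And>t. j \<le> t \<Longrightarrow> t < b \<Longrightarrow> \<not> ?H (Suc t)"
      using LeastI[of "\<lambda>t. j \<le> t \<and> ?H (Suc t)"] not_less_Least[of _ "\<lambda>t. j \<le> t \<and> ?H (Suc t)"]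
      unfolding b_def by blast+
    have out: "\<not> ?H t" if "a < t" "t \<le> b" for t
    proof (cases "t \<le> j")
      case True
      then show ?thesis using a_max that by force
    next
      case False
      then show ?thesis using b_min[of "t - 1"] that by (simp add: Suc_diff_1)
    qed
    have "E (?c b) (prev u)"
      using target_range[OF u prev_K[OF u] E, of b] b out aj by simp
    moreover have "E (?c b) (?c a)"
    proof (rule target_range[OF u aK, of "Suc a" b])
      show "E (?c (Suc a)) (?c a)" using E_prev prev_pow_V u by simp
    qed (use b aj out in auto)
    moreover have "?c b \<notin> K u" "?c b \<noteq> u" using out[of b] b aj by auto
    ultimately have "prev u = ?c a"
      using target_unique[OF u prev_pow_V[OF u, of b] _ _ _ prev_K[OF u] _ aK] b by simp
    then have "(prev ^^ 1) u = (prev ^^ 1) ((prev ^^ (a - 1)) u)"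
      using a1 unfolding prev_pow_commute by simp
    then have "period u dvd a - 1" unfolding prev_pow_inj using period(1) by metis
    then show False using a1 aj j by (auto dest: dvd_imp_le)
  qed
qed

lemma in_arcs_orbit:
  assumes u: "u \<in> V" and d: "d < period u"
  shows "E ((prev ^^ (b + d)) u) ((prev ^^ b) u) \<longleftrightarrow> 1 \<le> d \<and> d + 1 < next_hit u"
proof -
  \<comment> \<open>One step before time \<open>b\<close>, so that \<open>prev w\<close> is the head
    of the arc and \<open>in_arcs_prev\<close> applies with \<open>j = d + 1\<close>. The added
    period covers the case \<open>b = 0\<close>.\<close>
  define w where "w = (prev ^^ (b + period u - 1)) u"
  have pos: "period u > 0" by (rule period)
  have per: "(prev ^^ (i + period u)) u = (prev ^^ i) u" for i
    using period(1)[of "period u" u] by (simp add: funpow_add)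
  have "(prev ^^ (d + 1)) w = (prev ^^ (b + d)) u"
    unfolding w_def prev_pow_commute using per[of "b + d"] pos by (simp add: algebra_simps)
  moreover have "prev w = (prev ^^ 1) w" by simp
  then have "prev w = (prev ^^ b) u"
    unfolding w_def prev_pow_commute using per[of b] pos by (simp add: algebra_simps)
  moreover have "w \<in> V" "period w = period u" "next_hit w = next_hit u"
    unfolding w_def using u prev_pow_V period_pow next_hit_pow by auto
  ultimately show ?thesis using in_arcs_prev[of w "d + 1"] d by auto
qed

text \<open>Follow \<open>K u\<close> in steps of \<open>r + 1\<close> from \<open>prev u\<close>.
  The \<open>r\<close> vertices after a member dominate it, so they are not hits; the next one must
  be a hit, or it would inherit an arc of the excluded length \<open>r + 1\<close>. After the last
  member reached in this way, that hit is \<open>u\<close> itself.\<close>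

lemma period_decomp:
  assumes u: "u \<in> V"
  obtains m where "m \<ge> 1" "period u = (next_hit u - 1) * m + 1"
proof -
  let ?c = "\<lambda>i. (prev ^^ i) u" and ?n = "period u"
  define r where "r = next_hit u - 2"
  have r: "next_hit u = r + 2" "r \<ge> 1" "r + 2 \<le> ?n" using next_hit[OF u] unfolding r_def by auto
  let ?P = "\<lambda>i. (r + 1) * i + 1 < ?n \<and> ?c ((r + 1) * i + 1) \<in> K u"
  define i where "i = (GREATEST i. ?P i)"
  have bound: "\<And>i. ?P i \<Longrightarrow> i \<le> ?n" by auto
  have P0: "?P 0" using prev_K u r by simp
  have Pi: "?P i" unfolding i_def by (rule GreatestI_nat[of ?P, OF P0 bound])
  have Pmax: "\<not> ?P (Suc i)" using Greatest_le_nat[of ?P "Suc i" ?n] bound unfolding i_def by fastforce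
  define a where "a = (r + 1) * i + 1"
  have a: "a < ?n" "?c a \<in> K u" using Pi unfolding a_def by auto
  have dom: "E (?c (a + j)) (?c a)" if "1 \<le> j" "j \<le> r" for j
    using in_arcs_orbit[OF u, of j a] that r by simp
  then have out: "?c (a + j) \<notin> K u" "?c (a + j) \<noteq> u" if "1 \<le> j" "j \<le> r" for j
    using that a K_indep[OF u] K_no[OF u] by metis+
  have "a + r < ?n"
  proof (rule ccontr)
    assume "\<not> ?thesis"
    then have "1 \<le> ?n - a" "?n - a \<le> r" "a + (?n - a) = ?n" using a by linarith+
    then show False using out(2)[of "?n - a"] period(1)[of ?n u] by simp
  qed
  have "a + r + 1 = ?n"
  proof (rule ccontr)
    assume "a + r + 1 \<noteq> ?n"
    then have lt: "a + r + 1 < ?n" using \<open>a + r < ?n\<close> by simp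
    have "a + r + 1 = (r + 1) * Suc i + 1" unfolding a_def by simp
    then have nK: "?c (a + r + 1) \<notin> K u" using Pmax lt by metis
    have "?c (a + r + 1) \<noteq> u" using lt period(1)[of "a + r + 1" u] by (auto dest: dvd_imp_le)
    then have "E (?c (a + r + 1)) (?c a)"
      using target_prev[OF u prev_pow_V[OF u, of "a + r"] out[of r] _ _ a(2) dom[of r]] nK r by simp
    then show False using in_arcs_orbit[OF u, of "r + 1" a] r by (simp add: add.assoc)
  qed
  then show thesis using that[of "Suc i"] r unfolding a_def by simp
qed

lemma circular_orbit:
  assumes "V \<noteq> {}"
  obtains W n r m p where "W \<subseteq> V" "r \<ge> 1" "m \<ge> 1" "n = (r + 1) * m + 1" "circular E W n r p"
proof -
  obtain u where u: "u \<in> V" using assms by blast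
  define n where "n = period u"
  define r where "r = next_hit u - 2"
  \<comment> \<open>Arcs run against \<open>prev\<close>; with the sign, increasing labels follow
    the arcs.\<close>
  define p where "p z = (prev ^^ nat ((- z) mod int n)) u" for z
  have n: "n > 0" unfolding n_def by (rule period(2))
  obtain m where m: "m \<ge> 1" "n = (r + 1) * m + 1"
  proof -
    have "next_hit u - 1 = r + 1" using next_hit(1)[OF u] unfolding r_def by simp
    then show thesis using period_decomp[OF u] that unfolding n_def by metis
  qed
  have pmod: "(prev ^^ (i mod n)) u = (prev ^^ i) u" for i
    by (rule funpow_mod_eq) (simp add: period(1) n_def)
  have eq: "p a = p b \<longleftrightarrow> a mod int n = b mod int n" for a b
  proof -
    have "inj_on (\<lambda>i. (prev ^^ i) u) {..<n}"
    proof (rule linorder_inj_onI)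
      fix i j assume ij: "i < j" "i \<in> {..<n}" "j \<in> {..<n}"
      show "(prev ^^ i) u \<noteq> (prev ^^ j) u"
      proof
        assume "(prev ^^ i) u = (prev ^^ j) u"
        then have "(prev ^^ i) u = (prev ^^ i) ((prev ^^ (j - i)) u)"
          unfolding prev_pow_commute using ij by simp
        then have "n dvd j - i" using prev_pow_inj period(1) unfolding n_def by metis
        then show False using ij by (auto dest: dvd_imp_le)
      qed
    qed auto
    moreover have "nat (z mod int n) < n" for z :: int using n by (simp add: nat_less_iff)
    ultimately have "p a = p b \<longleftrightarrow> nat ((- a) mod int n) = nat ((- b) mod int n)"
      unfolding p_def by (auto dest: inj_onD)
    also have "\<dots> \<longleftrightarrow> (- a) mod int n = (- b) mod int n" using n by (simp add: eq_nat_nat_iff)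
    also have "\<dots> \<longleftrightarrow> a mod int n = b mod int n" by (metis minus_minus mod_minus_cong)
    finally show ?thesis .
  qed
  have arcs: "E (p a) (p b) \<longleftrightarrow> (b - a) mod int n \<in> {1..int r}" for a b
  proof -
    define A B d where "A = nat ((- a) mod int n)" and "B = nat ((- b) mod int n)"
      and "d = nat ((b - a) mod int n)"
    have i: "int A = (- a) mod int n" "int B = (- b) mod int n" "int d = (b - a) mod int n"
      unfolding A_def B_def d_def using n by simp_all
    have "int ((B + d) mod n) = int (A mod n)"
      unfolding zmod_int of_nat_add i by (simp add: mod_simps)
    then have "(B + d) mod n = A mod n" by simp
    then have "p a = (prev ^^ (B + d)) u" unfolding p_def A_def[symmetric] using pmod by metis
    moreover have "p b = (prev ^^ B) u" unfolding p_def B_def ..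
    moreover have "d < n" unfolding d_def using n by (simp add: nat_less_iff)
    ultimately have "E (p a) (p b) \<longleftrightarrow> 1 \<le> d \<and> d \<le> r"
      using in_arcs_orbit[OF u, of d B] next_hit(1)[OF u] unfolding n_def r_def by auto
    then show ?thesis using i(3) by auto
  qed
  have "range p \<subseteq> V" unfolding p_def using prev_pow_V u by blast
  moreover have "r \<ge> 1" unfolding r_def using next_hit(1)[OF u] by simp
  moreover have "circular E (range p) n r p" unfolding circular_def using eq arcs by blast
  ultimately show thesis using that m by blast
qed

end

section \<open>Critical kernel-free vertex sets\<close>

lemma right_inverse_imp_left_inverse_on:
  fixes A B :: "'a \<Rightarrow> 'a \<Rightarrow> real"
  assumes fin: "finite V"
    and inv: "\<And>x y. \<lbrakk>x \<in> V; y \<in> V\<rbrakk> \<Longrightarrow> (\<Sum>z\<in>V. A x z * B z y) = of_bool (x = y)"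
    and xy: "x \<in> V" "y \<in> V"
  shows "(\<Sum>z\<in>V. B x z * A z y) = of_bool (x = y)"
proof -
  define n where "n = card V"
  \<comment> \<open>An enumeration of \<open>V\<close> turns both families into square matrices, for
    which a right inverse is also a left inverse.\<close>
  obtain h where h: "bij_betw h {0..<n} V"
    using ex_bij_betw_nat_finite[OF fin] unfolding n_def by blast
  have hV: "h i \<in> V" if "i < n" for i using bij_betw_apply[OF h, of i] that by simp
  have hinj: "h i = h j \<longleftrightarrow> i = j" if "i < n" "j < n" for i j
    using bij_betw_imp_inj_on[OF h] that by (auto dest: inj_onD)
  have sum: "(\<Sum>z\<in>V. f z) = (\<Sum>i = 0..<n. f (h i))" for f :: "'a \<Rightarrow> real"
    using sum.reindex_bij_betw[OF h, of f] by simp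
  define MA where "MA = mat n n (\<lambda>(i, j). A (h i) (h j))"
  define MB where "MB = mat n n (\<lambda>(i, j). B (h i) (h j))"
  have c: "MA \<in> carrier_mat n n" "MB \<in> carrier_mat n n" unfolding MA_def MB_def by auto
  have "MA * MB = 1\<^sub>m n"
  proof (rule eq_matI)
    fix i j assume "i < dim_row (1\<^sub>m n :: real mat)" "j < dim_col (1\<^sub>m n :: real mat)"
    then show "(MA * MB) $$ (i, j) = 1\<^sub>m n $$ (i, j)"
      using inv[of "h i" "h j"] hV hinj unfolding MA_def MB_def sum
      by (auto simp: scalar_prod_def)
  qed (use c in auto)
  then have BA: "MB * MA = 1\<^sub>m n" using mat_mult_left_right_inverse c by blast
  obtain i j where ij: "i < n" "j < n" "h i = x" "h j = y"
    using xy bij_betw_imp_surj_on[OF h] by (metis atLeastLessThan_iff image_iff)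
  have "(MB * MA) $$ (i, j) = (\<Sum>z\<in>V. B x z * A z y)"
    using ij unfolding MA_def MB_def sum by (auto simp: scalar_prod_def)
  then show ?thesis using ij hinj unfolding BA by auto
qed

text \<open>In matrix terms, \<open>AK = J - I\<close> for 0-1 matrices implies \<open>KA = J - I\<close>, with constant column
  sums of \<open>A\<close>: \<open>K(J/(n-1) - I)\<close> is a right inverse, hence a left inverse, of \<open>A\<close>.\<close>

lemma complement_identity_commute:
  fixes a k :: "'a \<Rightarrow> 'a \<Rightarrow> bool"
  assumes fin: "finite V" and two: "card V \<ge> 2"
    and ak: "\<And>v u. \<lbrakk>v \<in> V; u \<in> V\<rbrakk> \<Longrightarrow> card {w \<in> V. a v w \<and> k w u} = of_bool (v \<noteq> u)"
  obtains \<alpha> where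
    "\<And>i j. \<lbrakk>i \<in> V; j \<in> V\<rbrakk> \<Longrightarrow> card {u \<in> V. k i u \<and> a u j} = of_bool (i \<noteq> j)"
    "\<And>j. j \<in> V \<Longrightarrow> card {v \<in> V. a v j} = \<alpha>"
    "\<And>i. i \<in> V \<Longrightarrow> card {u \<in> V. k i u} * \<alpha> + 1 = card V"
proof -
  define n where "n = card V"
  define A where "A x y = (of_bool (a x y) :: real)" for x y
  define K where "K x y = (of_bool (k x y) :: real)" for x y
  define \<kappa> where "\<kappa> i = card {u \<in> V. k i u}" for i
  define \<alpha> where "\<alpha> j = card {v \<in> V. a v j}" for j
  define M where "M i j = card {u \<in> V. k i u \<and> a u j}" for i j
  have cnt: "real (card {u \<in> V. P u}) = (\<Sum>u\<in>V. of_bool (P u))" for P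
    using fin by (simp add: of_bool_def sum.If_cases Int_def)
  have AK: "(\<Sum>w\<in>V. A v w * K w u) = of_bool (v \<noteq> u)" if "v \<in> V" "u \<in> V" for v u
    using ak[OF that] cnt[of "\<lambda>w. a v w \<and> k w u"] unfolding A_def K_def of_bool_conj by simp
  have sum_ne: "(\<Sum>u\<in>V. of_bool (v \<noteq> u)) = real n - 1" if "v \<in> V" for v
  proof -
    have "{u \<in> V. v \<noteq> u} = V - {v}" by blast
    then show ?thesis using cnt[of "\<lambda>u. v \<noteq> u"] that fin two unfolding n_def by simp
  qed
  \<comment> \<open>The entries of K(J/(n-1) - I), with the row sums \<open>\<kappa>\<close> in
    place of KJ.\<close>
  define R where "R w u = real (\<kappa> w) / (real n - 1) - K w u" for w u
  have n1: "real n - 1 > 0" using two unfolding n_def by simp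
  have AR: "(\<Sum>w\<in>V. A v w * R w u) = of_bool (v = u)" if "v \<in> V" "u \<in> V" for v u
  proof -
    have "(\<Sum>w\<in>V. A v w * real (\<kappa> w)) = (\<Sum>w\<in>V. \<Sum>u\<in>V. A v w * K w u)"
      unfolding \<kappa>_def cnt K_def sum_distrib_left ..
    also have "\<dots> = (\<Sum>u\<in>V. \<Sum>w\<in>V. A v w * K w u)" by (rule sum.swap)
    also have "\<dots> = real n - 1" using AK that sum_ne by simp
    finally have "(\<Sum>w\<in>V. A v w * (real (\<kappa> w) / (real n - 1))) = 1"
      using n1 by (simp flip: sum_divide_distrib)
    then show ?thesis using AK[OF that] unfolding R_def by (simp add: right_diff_distrib sum_subtractf)
  qed
  have RA: "real (\<kappa> i) * real (\<alpha> j) / (real n - 1) - real (M i j) = of_bool (i = j)"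
    if "i \<in> V" "j \<in> V" for i j
  proof -
    have "(\<Sum>u\<in>V. R i u * A u j) = of_bool (i = j)"
      using right_inverse_imp_left_inverse_on[of V A R, OF fin AR that] .
    moreover have "(\<Sum>u\<in>V. R i u * A u j) =
        real (\<kappa> i) / (real n - 1) * (\<Sum>u\<in>V. A u j) - (\<Sum>u\<in>V. K i u * A u j)"
      unfolding R_def by (simp add: left_diff_distrib sum_subtractf sum_distrib_left)
    moreover have "(\<Sum>u\<in>V. A u j) = real (\<alpha> j)" unfolding \<alpha>_def cnt A_def ..
    moreover have "(\<Sum>u\<in>V. K i u * A u j) = real (M i j)"
      unfolding M_def cnt A_def K_def of_bool_conj ..
    ultimately show ?thesis by simp
  qed
  \<comment> \<open>A witness \<open>u\<close> would contribute to the diagonal entry of AK at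
    \<open>u\<close>, which is zero.\<close>
  have M0: "M i i = 0" if "i \<in> V" for i
  proof -
    have "\<not> (k i u \<and> a u i)" if "u \<in> V" for u
    proof
      assume "k i u \<and> a u i"
      then have "i \<in> {w \<in> V. a u w \<and> k w u}" using \<open>i \<in> V\<close> by simp
      then show False using ak[OF that that] fin by (auto simp: card_eq_0_iff)
    qed
    then show ?thesis unfolding M_def by (simp add: card_eq_0_iff)
  qed
  have ka: "real (\<kappa> i) * real (\<alpha> i) = real n - 1" if "i \<in> V" for i
    using RA[OF that that] M0[OF that] n1 by (simp add: field_simps)
  have pos: "real (\<alpha> i) > 0" "real (\<kappa> i) > 0" if "i \<in> V" for i
    using ka[OF that] n1 by (metis less_irrefl mult_zero_left mult_zero_right of_nat_0_less_iff of_nat_0 neq0_conv)+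
  \<comment> \<open>Off the diagonal, RA = I makes \<open>\<alpha> j\<close> a natural multiple of
    \<open>\<alpha> i\<close>. By positivity and symmetry in \<open>i\<close> and \<open>j\<close>
    all column sums agree, and the multiplier \<open>M i j\<close> is 1.\<close>
  have aM: "\<alpha> j = M i j * \<alpha> i" if "i \<in> V" "j \<in> V" "i \<noteq> j" for i j
  proof -
    have "real (\<kappa> i) * real (\<alpha> j) / (real n - 1) = real (M i j)"
      using RA[OF that(1,2)] that(3) by simp
    then have "real (\<kappa> i) * real (\<alpha> j) = real (M i j) * (real n - 1)"
      using n1 by (metis less_irrefl nonzero_divide_eq_eq)
    also have "\<dots> = real (\<kappa> i) * (real (M i j) * real (\<alpha> i))" unfolding ka[OF that(1), symmetric] by simp
    finally have "real (\<alpha> j) = real (M i j) * real (\<alpha> i)"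
      using pos[OF that(1)] by (simp only: mult_cancel_left) simp
    then show ?thesis by (metis of_nat_eq_iff of_nat_mult)
  qed
  have le: "\<alpha> i \<le> \<alpha> j" if "i \<in> V" "j \<in> V" for i j
  proof (cases "i = j")
    case False
    have "\<alpha> j > 0" using pos(1)[OF that(2)] by simp
    then have "M i j \<ge> 1" using aM[OF that False] by (cases "M i j") simp_all
    then show ?thesis unfolding aM[OF that False] by (cases "M i j") simp_all
  qed simp
  obtain v where v: "v \<in> V" using two by fastforce
  have const: "\<alpha> j = \<alpha> v" if "j \<in> V" for j using le that v by (simp add: eq_iff)
  have "M i j = of_bool (i \<noteq> j)" if "i \<in> V" "j \<in> V" for i j
  proof (cases "i = j")
    case True
    then show ?thesis using M0[OF that(1)] by simp
  next
    case False
    have "\<alpha> v = M i j * \<alpha> v" using aM[OF that False] const[OF that(1)] const[OF that(2)] by metis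
    then show ?thesis using False pos(1)[OF v] by simp
  qed
  moreover have "\<kappa> i * \<alpha> v + 1 = card V" if "i \<in> V" for i
  proof -
    have "real (\<kappa> i * \<alpha> v + 1) = real n" using ka[OF that] const[OF that] by simp
    then show ?thesis unfolding n_def by linarith
  qed
  ultimately show thesis using that[of "\<alpha> v"] const unfolding M_def \<kappa>_def \<alpha>_def by blast
qed

section \<open>Odd cycles and circulants as kernel-free configurations\<close>

definition kernel_on :: "('a \<Rightarrow> 'a \<Rightarrow> bool) \<Rightarrow> 'a set \<Rightarrow> 'a set \<Rightarrow> bool" where
  "kernel_on E W S \<longleftrightarrow> S \<subseteq> W \<and> (\<forall>x\<in>S. \<forall>y\<in>S. \<not> E x y) \<and> (\<forall>x\<in>W - S. \<exists>y\<in>S. E x y)"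

text \<open>The only out-neighbour of \<open>q j\<close> in \<open>W\<close> is
  \<open>q (Suc j)\<close>, so membership in a kernel alternates along the cycle, which an odd
  length forbids.\<close>

lemma odd_cycle_no_kernel:
  fixes q :: "nat \<Rightarrow> 'a"
  assumes "odd l" "q l = q 0" "\<And>j. q j \<in> W"
    and arc: "\<And>j. j < l \<Longrightarrow> E (q j) (q (Suc j))"
    and only: "\<And>j y. \<lbrakk>j < l; y \<in> W; E (q j) y\<rbrakk> \<Longrightarrow> y = q (Suc j)"
  shows "\<not> kernel_on E W S"
proof
  assume S: "kernel_on E W S"
  have "q j \<in> S \<longleftrightarrow> (q 0 \<in> S \<longleftrightarrow> even j)" if "j \<le> l" for j
    using that
  proof (induction j)
    case (Suc j)
    have "q (Suc j) \<in> S \<longleftrightarrow> q j \<notin> S"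
      using S arc[of j] only[of j] Suc.prems assms(3) unfolding kernel_on_def
      by (metis DiffI Suc_le_lessD subset_eq)
    then show ?case using Suc by auto
  qed simp
  then show False using assms(1,2) by (metis order_refl)
qed

text \<open>If \<open>p a\<close> is in a kernel, so is \<open>p (a - (r + 1))\<close>: otherwise
  the absorber of the latter is one of the \<open>r\<close> vertices in between, all of which
  dominate \<open>p a\<close>. After \<open>m\<close> such steps the label is \<open>a + 1\<close>
  modulo \<open>n\<close>, an out-neighbour of \<open>p a\<close>.\<close>

lemma circular_no_kernel:
  assumes circ: "circular E W n r p" and r: "r \<ge> 1" and n: "n = (r + 1) * m + 1" "m \<ge> 1"
  shows "\<not> kernel_on E W S"
proof
  assume S: "kernel_on E W S"
  have W: "range p = W" and eq: "\<And>a b. p a = p b \<longleftrightarrow> a mod int n = b mod int n"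
    and E: "\<And>a b. E (p a) (p b) \<longleftrightarrow> (b - a) mod int n \<in> {1..int r}"
    using circ unfolding circular_def by auto
  have "r + 1 \<le> (r + 1) * m" using mult_le_mono2[OF n(2), of "r + 1"] by simp
  then have rn: "r + 1 < n" using n(1) by linarith
  have step: "p (a - (int r + 1)) \<in> S" if a: "p a \<in> S" for a
  proof (rule ccontr)
    assume "p (a - (int r + 1)) \<notin> S"
    then obtain y where y: "y \<in> S" "E (p (a - (int r + 1))) y"
      using S W unfolding kernel_on_def by blast
    then obtain b where b: "y = p b" using S W unfolding kernel_on_def by blast
    define d where "d = (b - (a - (int r + 1))) mod int n"
    have d: "1 \<le> d" "d \<le> int r" using y(2) unfolding b E d_def by auto
    have "(a - b) mod int n = ((int r + 1) - d) mod int n"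
      unfolding d_def by (simp add: mod_simps algebra_simps)
    also have "\<dots> = int r + 1 - d" using d rn by simp
    finally have "E (p b) (p a)" unfolding E using d by simp
    then show False using S y a unfolding b kernel_on_def by blast
  qed
  have steps: "p (a - (int r + 1) * int i) \<in> S" if "p a \<in> S" for a i
  proof (induction i)
    case (Suc i)
    then show ?case using step[OF Suc.IH] by (simp add: algebra_simps)
  qed (use that in simp)
  have "p 0 \<in> S \<or> (\<exists>y\<in>S. E (p 0) y)" using S W unfolding kernel_on_def by blast
  then obtain a where a: "p a \<in> S" using S W unfolding kernel_on_def by blast
  have "p (a + 1) = p (a - (int r + 1) * int m)"
  proof -
    have "a + 1 = a - (int r + 1) * int m + int n" using n(1) by (simp add: algebra_simps)
    then show ?thesis unfolding eq by (metis mod_add_self2)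
  qed
  then have "p (a + 1) \<in> S" using steps[OF a] by simp
  moreover have "E (p a) (p (a + 1))" unfolding E using rn r by simp
  ultimately show False using a S unfolding kernel_on_def by blast
qed

lemma circular_converse:
  assumes "circular E W n r p"
  shows "circular (\<lambda>x y. E y x) W n r (\<lambda>z. p (- z))"
proof -
  have "range (\<lambda>z. p (- z)) = range p"
    by (metis (no_types) image_image surj_uminus)
  moreover have "(- a) mod int n = (- b) mod int n \<longleftrightarrow> a mod int n = b mod int n" for a b
    by (metis minus_minus mod_minus_cong)
  ultimately show ?thesis using assms unfolding circular_def by simp
qed

text \<open>With clockwise steps of length at most \<open>r\<close>, any two consecutive ones of total length more
  than \<open>r\<close>, the positions below trace out an induced cycle with \<open>2m - 1\<close> vertices.\<close>

lemma circular_odd_cycle: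
  assumes circ: "circular E W n r p" and n: "n = (r + 1) * m + 1"
    and r: "r \<ge> 2" and m: "m \<ge> 2" and rm: "r \<noteq> 2 \<or> m \<noteq> 2"
  obtains U where "U \<subset> W" "\<And>S. \<not> kernel_on E U S"
proof -
  have W: "range p = W" and eq: "\<And>a b. p a = p b \<longleftrightarrow> a mod int n = b mod int n"
    and E: "\<And>a b. E (p a) (p b) \<longleftrightarrow> (b - a) mod int n \<in> {1..int r}"
    using circ unfolding circular_def by auto
  define e where "e i = min 2 ((r - 1) * i)" for i
  define P where "P j = (r + 1) * (j div 2) + e (j div 2) + r * (j mod 2)" for j
  define l where "l = 2 * m - 1"
  have e: "e i \<le> e (Suc i)" "e (Suc i) \<le> e i + (r - 1)" "e 0 = 0" for i
    unfolding e_def by (auto simp: min_def)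
  have em: "e (m - 1) = 2"
  proof -
    have "(r - 1) * (m - 1) \<ge> 2"
    proof (cases "r = 2")
      case True
      then show ?thesis using rm m by simp
    next
      case False
      then have "2 * 1 \<le> (r - 1) * (m - 1)" using r m by (intro mult_le_mono) auto
      then show ?thesis by simp
    qed
    then show ?thesis unfolding e_def by simp
  qed
  have P0: "P 0 = 0" and P1: "P 1 = r" unfolding P_def using e by simp_all
  have two: "P j + (r + 1) \<le> P (j + 2)" for j
    unfolding P_def using e(1)[of "j div 2"] by simp
  have one: "P j + 1 \<le> P (Suc j) \<and> P (Suc j) \<le> P j + r" for j
  proof (cases "even j")
    case True
    then show ?thesis unfolding P_def using r by (auto elim!: evenE)
  next
    case False
    then obtain i where "j = 2 * i + 1" by (auto elim: oddE)
    then show ?thesis unfolding P_def using e(1,2)[of i] r by simp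
  qed
  have mono: "P i < P j" if "i < j" for i j
    using that by (rule lift_Suc_mono_less[of P, rotated]) (use one in \<open>simp add: Suc_le_eq\<close>)
  have mono': "P i \<le> P j" if "i \<le> j" for i j
    using mono that by (metis le_eq_less_or_eq)
  have Pl: "P l = n"
  proof -
    have "l = 2 * (m - 1) + 1" unfolding l_def using m by simp
    then have "P l = (r + 1) * (m - 1) + 2 + r" unfolding P_def using em by simp
    also have "\<dots> = (r + 1) * (m - 1 + 1) + 1" by (simp add: algebra_simps)
    also have "\<dots> = n" using n m by simp
    finally show ?thesis .
  qed
  have Plt: "P j < n" if "j < l" for j using mono[OF that] Pl by simp
  have Pl1: "P (l - 1) + r = n"
  proof -
    have "l - 1 = 2 * (m - 1)" unfolding l_def using m by simp
    then have "P (l - 1) + r = (r + 1) * (m - 1) + 2 + r" unfolding P_def using em by simp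
    also have "\<dots> = (r + 1) * (m - 1 + 1) + 1" by (simp add: algebra_simps)
    also have "\<dots> = n" using n m by simp
    finally show ?thesis .
  qed
  have l: "l \<ge> 3" "odd l" unfolding l_def using m by auto
  define q where "q j = p (int (P j))" for j
  \<comment> \<open>Skipping a vertex covers a distance of at least \<open>r + 1\<close>, so forward
    arcs join consecutive vertices only.\<close>
  have up: "E (q i) (q j) \<longleftrightarrow> j = Suc i" if "i < j" "j < l" for i j
  proof -
    have "(int (P j) - int (P i)) mod int n = int (P j) - int (P i)"
      using mono[OF that(1)] Plt[OF that(2)] by simp
    then have "E (q i) (q j) \<longleftrightarrow> P j - P i \<le> r" unfolding q_def E using mono[OF that(1)] by auto
    moreover have "P i + (r + 1) \<le> P j" if "j \<noteq> Suc i"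
      using two[of i] mono'[of "i + 2" j] that \<open>i < j\<close> by simp
    ultimately show ?thesis using one[of i] by (cases "j = Suc i") auto
  qed
  \<comment> \<open>The last vertex is at distance exactly \<open>r\<close> from label
    \<open>n\<close>, all earlier ones at distance more than \<open>r\<close>.\<close>
  have down: "E (q i) (q j) \<longleftrightarrow> i = l - 1 \<and> j = 0" if "j \<le> i" "i < l" for i j
  proof (cases "j = i")
    case True
    then show ?thesis using l unfolding q_def E by auto
  next
    case False
    have Pji: "P j < P i" using mono that False by simp
    have "(int (P j) - int (P i)) mod int n = (int n + int (P j) - int (P i)) mod int n"
      by (metis add.commute add_diff_eq mod_add_self2)
    also have "\<dots> = int n + int (P j) - int (P i)" using Pji Plt[OF that(2)] by simp
    finally have "E (q i) (q j) \<longleftrightarrow> n + P j - P i \<le> r"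
      unfolding q_def E using Pji Plt[OF that(2)] by auto
    also have "\<dots> \<longleftrightarrow> i = l - 1 \<and> j = 0"
    proof (cases "i = l - 1")
      case True
      then show ?thesis using Pl1 P0 mono[of 0 j] by (cases "j = 0") auto
    next
      case False
      then have "i + 2 \<le> l" using that(2) by linarith
      then have "P i + (r + 1) \<le> n" using two[of i] mono'[of "i + 2" l] Pl by simp
      then show ?thesis using False by simp
    qed
    finally show ?thesis .
  qed
  define U where "U = q ` {..<l}"
  have ql: "q l = q 0" unfolding q_def eq Pl P0 by simp
  have U: "U = q ` {..l}"
  proof -
    have "{..l} = insert l {..<l}" by auto
    then show ?thesis unfolding U_def using ql l by (auto intro!: image_eqI[of _ q 0])
  qed
  have nokernel: "\<not> kernel_on E U S" for S
  \<comment> \<open>The rule wants a sequence that stays in \<open>U\<close> at all indices, hence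
    the truncation at \<open>l\<close>.\<close>
  proof (rule odd_cycle_no_kernel[of l "\<lambda>j. q (min j l)"])
    show "q (min l l) = q (min 0 l)" using ql by simp
    show "q (min j l) \<in> U" for j unfolding U by auto
    show "E (q (min j l)) (q (min (Suc j) l))" if "j < l" for j
    proof (cases "Suc j = l")
      case True
      then show ?thesis using down[of 0 j] that ql by (auto simp: min_def)
    next
      case False
      then show ?thesis using up[of j "Suc j"] that by (auto simp: min_def)
    qed
    show "y = q (min (Suc j) l)" if jl: "j < l" and y: "y \<in> U" "E (q (min j l)) y" for j y
    proof -
      obtain i where i: "y = q i" "i < l" using y(1) unfolding U_def by auto
      have "E (q j) (q i)" using y(2) i jl by (simp add: min_def)
      then show ?thesis using up[of j i] down[of i j] i jl ql by (cases "j < i") (auto simp: min_def)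
    qed
  qed (rule l)
  \<comment> \<open>The first step leads from label 0 to label \<open>r \<ge> 2\<close>, so the
    cycle misses label 1.\<close>
  have "p 1 \<notin> U"
  proof
    assume "p 1 \<in> U"
    then obtain j where j: "j < l" "p 1 = p (int (P j))" unfolding U_def q_def by auto
    have "1 mod int n = int (P j) mod int n" using j(2) unfolding eq .
    moreover have "1 mod int n = 1" using Plt[of 1] P1 r l by simp
    moreover have "int (P j) mod int n = int (P j)" using Plt[OF j(1)] by simp
    ultimately have "P j = 1" by linarith
    then show False using P0 P1 r mono'[of 1 j] by (cases "j = 0") auto
  qed
  moreover have "U \<subseteq> W" unfolding U_def q_def using W by auto
  ultimately have "U \<subset> W" using W by blast
  then show thesis using that nokernel by blast
qed

section \<open>Critical sets and their kernel systems\<close>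

definition critical :: "('a \<Rightarrow> 'a \<Rightarrow> bool) \<Rightarrow> 'a set \<Rightarrow> bool" where
  "critical E W \<longleftrightarrow> finite W \<and> (\<nexists>S. kernel_on E W S) \<and> (\<forall>U. U \<subset> W \<longrightarrow> (\<exists>S. kernel_on E U S))"

text \<open>If \<open>K v\<close> absorbed \<open>v\<close>, it would be a kernel of
  \<open>W\<close>. The set \<open>insert v (K v)\<close> is absorbent, so it must fail to be
  independent, through an arc from \<open>K v\<close> to \<open>v\<close>.\<close>

lemma critical_kernels:
  assumes "critical E W" and irrefl: "\<And>x. \<not> E x x"
  obtains K where "\<And>v. v \<in> W \<Longrightarrow> kernel_on E (W - {v}) (K v)"
    "\<And>v k. \<lbrakk>v \<in> W; k \<in> K v\<rbrakk> \<Longrightarrow> \<not> E v k" "\<And>v. v \<in> W \<Longrightarrow> \<exists>k\<in>K v. E k v"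
proof -
  have no: "\<not> kernel_on E W S" for S using assms unfolding critical_def by blast
  have "\<forall>v. \<exists>S. v \<in> W \<longrightarrow> kernel_on E (W - {v}) S" using assms unfolding critical_def by blast
  then obtain K where K: "\<And>v. v \<in> W \<Longrightarrow> kernel_on E (W - {v}) (K v)" by metis
  have 1: "\<not> E v k" if "v \<in> W" "k \<in> K v" for v k
    using no[of "K v"] K[OF that(1)] that unfolding kernel_on_def by blast
  have "\<exists>k\<in>K v. E k v" if "v \<in> W" for v
    using no[of "insert v (K v)"] K[OF that] 1[OF that] that irrefl unfolding kernel_on_def by blast
  then show thesis using that K 1 by blast
qed

lemma critical_in_kernel_system:
  assumes crit: "critical E W" and irrefl: "\<And>x. \<not> E x x"
    and semi: "\<And>x y z. \<lbrakk>x \<in> W; y \<in> W; z \<in> W; E x z; E y z; x \<noteq> y\<rbrakk> \<Longrightarrow> E x y \<or> E y x"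
  obtains K where "kernel_system W E K"
proof -
  obtain K where K: "\<And>v. v \<in> W \<Longrightarrow> kernel_on E (W - {v}) (K v)"
    "\<And>v k. \<lbrakk>v \<in> W; k \<in> K v\<rbrakk> \<Longrightarrow> \<not> E v k" "\<And>v. v \<in> W \<Longrightarrow> \<exists>k\<in>K v. E k v"
    using critical_kernels[OF crit irrefl] by metis
  have "kernel_system W E K"
  proof
    show "finite W" using crit unfolding critical_def by blast
    show "E x y \<or> E y x" if "x \<in> W" "y \<in> W" "z \<in> W" "E x z" "E y z" "x \<noteq> y" for x y z
      using semi[OF that] .
    show "K v \<subseteq> W - {v}" if "v \<in> W" for v using K(1)[OF that] unfolding kernel_on_def by blast
    show "\<not> E x y" if "v \<in> W" "x \<in> K v" "y \<in> K v" for v x y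
      using K(1)[OF that(1)] that unfolding kernel_on_def by blast
    show "\<exists>k\<in>K v. E x k" if "v \<in> W" "x \<in> W" "x \<noteq> v" "x \<notin> K v" for v x
      using K(1)[OF that(1)] that unfolding kernel_on_def by blast
    show "\<not> E v k" if "v \<in> W" "k \<in> K v" for v k using K(2)[OF that] .
    show "\<exists>k\<in>K v. E k v" if "v \<in> W" for v using K(3)[OF that] .
  qed
  then show thesis using that by blast
qed

lemma critical_out_kernel_system:
  assumes crit: "critical E W" and irrefl: "\<And>x. \<not> E x x"
    and semi: "\<And>x y z. \<lbrakk>x \<in> W; y \<in> W; z \<in> W; E z x; E z y; x \<noteq> y\<rbrakk> \<Longrightarrow> E x y \<or> E y x"
  obtains K where "kernel_system W (\<lambda>x y. E y x) K"
proof -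
  have fin: "finite W" and no: "\<And>S. \<not> kernel_on E W S" using crit unfolding critical_def by blast+
  obtain K where K: "\<And>v. v \<in> W \<Longrightarrow> kernel_on E (W - {v}) (K v)"
    and K_no: "\<And>v k. \<lbrakk>v \<in> W; k \<in> K v\<rbrakk> \<Longrightarrow> \<not> E v k" and K_in: "\<And>v. v \<in> W \<Longrightarrow> \<exists>k\<in>K v. E k v"
    using critical_kernels[OF crit irrefl] by metis
  have KW: "k \<in> W" "k \<noteq> v" if "v \<in> W" "k \<in> K v" for v k
    using K[OF that(1)] that(2) unfolding kernel_on_def by auto
  have "W \<noteq> {}" using no[of "{}"] unfolding kernel_on_def by blast
  then obtain v where "v \<in> W" by blast
  then obtain k where "k \<in> W" "k \<noteq> v" using K_in KW by blast
  then have two: "card W \<ge> 2" using \<open>v \<in> W\<close> fin by (metis card_le_Suc0_iff_eq not_less_eq_eq numeral_2_eq_2)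
  define a where "a x y \<longleftrightarrow> x = y \<or> E x y" for x y
  \<comment> \<open>Closed out-neighbourhoods are cliques, so each meets an independent set at most
    once.\<close>
  have clique: "x = y" if "L \<subseteq> W" "\<And>x y. \<lbrakk>x \<in> L; y \<in> L\<rbrakk> \<Longrightarrow> \<not> E x y" "v \<in> W" "x \<in> L" "y \<in> L" "a v x" "a v y"
    for L v x y
    using that semi unfolding a_def by blast
  have ak: "card {w \<in> W. a v w \<and> w \<in> K u} = of_bool (v \<noteq> u)" if vu: "v \<in> W" "u \<in> W" for v u
  proof (cases "v = u")
    case True
    then have empty: "{w \<in> W. a v w \<and> w \<in> K u} = {}" using KW K_no vu unfolding a_def by blast
    show ?thesis unfolding empty using True by simp
  next
    case False
    obtain w where w: "w \<in> K u" "a v w"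
      using K[OF vu(2)] vu False unfolding kernel_on_def a_def by blast
    have "{w \<in> W. a v w \<and> w \<in> K u} = {w}"
      using w clique[of "K u" v] KW[OF vu(2)] K[OF vu(2)] vu unfolding kernel_on_def by blast
    then show ?thesis using False by simp
  qed
  obtain \<alpha> where ka: "\<And>i j. \<lbrakk>i \<in> W; j \<in> W\<rbrakk> \<Longrightarrow> card {u \<in> W. i \<in> K u \<and> a u j} = of_bool (i \<noteq> j)"
    and \<alpha>: "\<And>j. j \<in> W \<Longrightarrow> card {v \<in> W. a v j} = \<alpha>"
    and \<kappa>: "\<And>i. i \<in> W \<Longrightarrow> card {u \<in> W. i \<in> K u} * \<alpha> + 1 = card W"
    using complement_identity_commute[of W a "\<lambda>w u. w \<in> K u", OF fin two ak] by blast
  \<comment> \<open>By the dual count, \<open>K' i\<close> meets the closed in-neighbourhood of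
    \<open>j\<close> once if \<open>j \<noteq> i\<close> and never if \<open>j = i\<close>. In the
    converse digraph this yields absorption and independence.\<close>
  define K' where "K' i = {u \<in> W. i \<in> K u}" for i
  have hit: "\<exists>u\<in>K' i. a u j" if "i \<in> W" "j \<in> W" "i \<noteq> j" for i j
  proof -
    have "{u \<in> W. i \<in> K u \<and> a u j} \<noteq> {}" using ka[OF that(1,2)] that(3) by fastforce
    then show ?thesis unfolding K'_def by blast
  qed
  have nohit: "\<not> a u i" if "i \<in> W" "u \<in> K' i" for i u
  proof -
    have "{u \<in> W. i \<in> K u \<and> a u i} = {}" using ka[OF that(1,1)] fin by simp
    then show ?thesis using that(2) unfolding K'_def by blast
  qed
  have unique: "u = u'" if "i \<in> W" "j \<in> W" "u \<in> K' i" "u' \<in> K' i" "a u j" "a u' j" for i j u u'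
  proof -
    let ?S = "{u \<in> W. i \<in> K u \<and> a u j}"
    have "card ?S \<le> Suc 0" using ka[OF that(1,2)] by simp
    moreover have "u \<in> ?S" "u' \<in> ?S" using that unfolding K'_def by auto
    moreover have "finite ?S" using fin by simp
    ultimately show ?thesis using card_le_Suc0_iff_eq by blast
  qed
  have indep: "\<not> E x y" if "i \<in> W" "x \<in> K' i" "y \<in> K' i" for i x y
    using unique[of i y x y] that irrefl unfolding a_def K'_def by blast
  \<comment> \<open>A packing argument for \<open>K_in\<close> in the converse. If it fails,
    \<open>L\<close> is independent, so the closed in-neighbourhoods of its
    \<open>card (K' i) + 1\<close> members are disjoint sets of size \<open>\<alpha>\<close> inside
    a set of size \<open>card (K' i) * \<alpha> + 1\<close>. Then \<open>\<alpha> \<le> 1\<close>,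
    there is no arc within \<open>W\<close>, and \<open>W\<close> is its own kernel.\<close>
  have "\<exists>k\<in>K' i. E i k" if i: "i \<in> W" for i
  proof (rule ccontr)
    assume neg: "\<not> (\<exists>k\<in>K' i. E i k)"
    define L where "L = insert i (K' i)"
    have L: "L \<subseteq> W" "finite L" unfolding L_def K'_def using i fin by auto
    have L_indep: "\<not> E x y" if "x \<in> L" "y \<in> L" for x y
      using that neg indep[OF i] nohit[OF i] irrefl unfolding L_def a_def by blast
    have "i \<notin> K' i" using KW i unfolding K'_def by blast
    then have "card L = card (K' i) + 1" unfolding L_def using L(2) L_def by simp
    then have "card L * \<alpha> + 1 = card W + \<alpha>" using \<kappa>[OF i] unfolding K'_def by (simp add: algebra_simps)
    moreover have "card L * \<alpha> = card (SIGMA j:L. {v \<in> W. a v j})"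
      using L fin \<alpha> by (subst card_SigmaI) (auto simp: subset_iff)
    moreover have "\<dots> = card (snd ` (SIGMA j:L. {v \<in> W. a v j}))"
    proof (rule card_image[symmetric], rule inj_onI)
      fix s t assume "s \<in> (SIGMA j:L. {v \<in> W. a v j})" "t \<in> (SIGMA j:L. {v \<in> W. a v j})" "snd s = snd t"
      then show "s = t" using clique[OF L(1) L_indep] by (auto simp: prod_eq_iff)
    qed
    moreover have "\<dots> \<le> card W" using fin by (intro card_mono) auto
    ultimately have "\<alpha> \<le> 1" by linarith
    have "\<not> E x y" if "x \<in> W" "y \<in> W" for x y
    proof
      assume "E x y"
      then have "card {x, y} \<le> card {v \<in> W. a v y}"
        using that fin unfolding a_def by (intro card_mono) auto
      then have "card {x, y} \<le> 1" using \<alpha>[OF that(2)] \<open>\<alpha> \<le> 1\<close> by simp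
      then show False using \<open>E x y\<close> irrefl by (cases "x = y") auto
    qed
    then show False using no[of W] unfolding kernel_on_def by blast
  qed
  then have "kernel_system W (\<lambda>x y. E y x) K'"
  proof unfold_locales
    show "finite W" by (rule fin)
    show "E y x \<or> E x y" if "x \<in> W" "y \<in> W" "z \<in> W" "E z x" "E z y" "x \<noteq> y" for x y z
      using semi[OF that] by blast
    show "\<not> E y x" if "v \<in> W" "x \<in> K' v" "y \<in> K' v" for v x y
      using indep[OF that(1,3,2)] .
    show "K' v \<subseteq> W - {v}" if "v \<in> W" for v using KW that unfolding K'_def by blast
    show "\<exists>k\<in>K' v. E k x" if "v \<in> W" "x \<in> W" "x \<noteq> v" "x \<notin> K' v" for v x
      using hit[of v x] that unfolding a_def by metis
    show "\<not> E k v" if "v \<in> W" "k \<in> K' v" for v k using nohit that unfolding a_def by blast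
  qed
  then show thesis using that by blast
qed

lemma critical_circular:
  assumes crit: "critical E W" and irrefl: "\<And>x. \<not> E x x"
    and semi: "(\<forall>x\<in>W. \<forall>y\<in>W. \<forall>z\<in>W. E x z \<and> E y z \<and> x \<noteq> y \<longrightarrow> E x y \<or> E y x) \<or>
      (\<forall>x\<in>W. \<forall>y\<in>W. \<forall>z\<in>W. E z x \<and> E z y \<and> x \<noteq> y \<longrightarrow> E x y \<or> E y x)"
  obtains n r m p where "r \<ge> 1" "m \<ge> 1" "n = (r + 1) * m + 1" "circular E W n r p"
    "r = 1 \<or> m = 1 \<or> r = 2 \<and> m = 2"
proof -
  have no: "\<And>S. \<not> kernel_on E W S" and proper: "\<And>U. U \<subset> W \<Longrightarrow> \<exists>S. kernel_on E U S"
    using crit unfolding critical_def by blast+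
  have ne: "W \<noteq> {}" using no[of "{}"] unfolding kernel_on_def by blast
  obtain U n r m p where U: "U \<subseteq> W" "r \<ge> 1" "m \<ge> 1" "n = (r + 1) * m + 1" "circular E U n r p"
  proof (cases "\<forall>x\<in>W. \<forall>y\<in>W. \<forall>z\<in>W. E x z \<and> E y z \<and> x \<noteq> y \<longrightarrow> E x y \<or> E y x")
    case True
    then obtain K where "kernel_system W E K"
      using critical_in_kernel_system[OF crit irrefl] by metis
    then interpret kernel_system W E K .
    obtain U n r m p where "U \<subseteq> W" "r \<ge> 1" "m \<ge> 1" "n = (r + 1) * m + 1" "circular E U n r p"
      by (rule circular_orbit[OF ne])
    then show thesis by (rule that)
  next
    case False
    then have "\<forall>x\<in>W. \<forall>y\<in>W. \<forall>z\<in>W. E z x \<and> E z y \<and> x \<noteq> y \<longrightarrow> E x y \<or> E y x" using semi by blast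
    then obtain K where "kernel_system W (\<lambda>x y. E y x) K"
      using critical_out_kernel_system[OF crit irrefl] by metis
    then interpret kernel_system W "\<lambda>x y. E y x" K .
    obtain U n r m p where U: "U \<subseteq> W" "r \<ge> 1" "m \<ge> 1" "n = (r + 1) * m + 1"
      "circular (\<lambda>x y. E y x) U n r p"
      by (rule circular_orbit[OF ne])
    \<comment> \<open>The orbit was found in the converse digraph; negating its labels restores the
      original direction.\<close>
    show thesis using that[OF U(1-4) circular_converse[OF U(5)]] .
  qed
  have "U = W" using circular_no_kernel[OF U(5,2,4,3)] proper U(1) by blast
  then have circ: "circular E W n r p" using U by simp
  have "r = 1 \<or> m = 1 \<or> r = 2 \<and> m = 2"
  proof (rule ccontr)
    assume "\<not> ?thesis"
    then have "r \<ge> 2" "m \<ge> 2" "r \<noteq> 2 \<or> m \<noteq> 2" using U by auto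
    then obtain X where "X \<subset> W" "\<And>S. \<not> kernel_on E X S"
      using circular_odd_cycle[OF circ U(4)] by metis
    then show False using proper by blast
  qed
  then show thesis using that U circ by blast
qed

section \<open>Directed cycles and circulants as digraphs\<close>

lemma kernel_on_cong:
  assumes "\<And>x y. \<lbrakk>x \<in> W; y \<in> W\<rbrakk> \<Longrightarrow> E x y \<longleftrightarrow> E' x y"
  shows "kernel_on E W S \<longleftrightarrow> kernel_on E' W S"
  using assms unfolding kernel_on_def by blast

lemma kernel_iff_kernel_on: "kernel D S \<longleftrightarrow> kernel_on (dominates D) (verts D) S"
  unfolding kernel_def kernel_on_def independent_def absorbent_def by blast

lemma dominates_iff: "u \<rightarrow>\<^bsub>D\<^esub> v \<longleftrightarrow> (\<exists>a\<in>arcs D. tail D a = u \<and> head D a = v)"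
  unfolding arcs_ends_conv by auto

lemma dominates_induce_subgraph_iff:
  "u \<rightarrow>\<^bsub>D \<restriction> W\<^esub> v \<longleftrightarrow> u \<in> W \<and> v \<in> W \<and> u \<rightarrow>\<^bsub>D\<^esub> v"
  unfolding dominates_iff by auto

lemma dominates_induced_subgraph:
  assumes "induced_subgraph H D" "u \<in> verts H" "v \<in> verts H"
  shows "u \<rightarrow>\<^bsub>H\<^esub> v \<longleftrightarrow> u \<rightarrow>\<^bsub>D\<^esub> v"
  using assms unfolding dominates_iff induced_subgraph_def subgraph_def compatible_def by auto

lemma kernel_induced_subgraph:
  assumes "induced_subgraph H D"
  shows "kernel H S \<longleftrightarrow> kernel_on (dominates D) (verts H) S"
  unfolding kernel_iff_kernel_on by (rule kernel_on_cong) (rule dominates_induced_subgraph[OF assms])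

lemma KP_digraph_iff:
  assumes "wf_digraph D"
  shows "KP_digraph D \<longleftrightarrow> (\<forall>W\<subseteq>verts D. \<exists>S. kernel_on (dominates D) W S)"
proof
  assume "KP_digraph D"
  then show "\<forall>W\<subseteq>verts D. \<exists>S. kernel_on (dominates D) W S"
    using wf_digraph.induced_induce[OF assms] kernel_induced_subgraph
    unfolding KP_digraph_def by (metis induce_subgraph_verts)
next
  assume *: "\<forall>W\<subseteq>verts D. \<exists>S. kernel_on (dominates D) W S"
  have "\<exists>S. kernel H S" if H: "induced_subgraph H D" for H
  proof -
    have "verts H \<subseteq> verts D" using H unfolding induced_subgraph_def subgraph_def by blast
    then show ?thesis using * kernel_induced_subgraph[OF H] by simp
  qed
  then show "KP_digraph D"
    using wf_digraph.induced_subgraph_refl[OF assms] unfolding KP_digraph_def by blast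
qed

section \<open>Directed cycles as closed walks\<close>

lemma (in pre_digraph) awalk_verts_nth:
  assumes "cas u p v" "j < length p"
  shows "awalk_verts u p ! j = tail G (p ! j)" "awalk_verts u p ! Suc j = head G (p ! j)"
proof -
  have "p \<noteq> []" using assms(2) by auto
  then show "awalk_verts u p ! j = tail G (p ! j)"
    using assms(2) unfolding awalk_verts_conv by (simp add: nth_append)
  show "awalk_verts u p ! Suc j = head G (p ! j)"
    using assms(2) \<open>p \<noteq> []\<close> unfolding awalk_verts_conv'[OF assms(1)] by simp
qed

lemma (in pre_digraph) cas_endpoints:
  assumes "cas u p v"
  shows "hd (awalk_verts u p) = u" "last (awalk_verts u p) = v"
  using assms by (induction u p v rule: cas.induct) auto

text \<open>Keeping \<open>q\<close> arbitrary lets the induction hypothesis be used for the shifted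
  sequence.\<close>

lemma (in pre_digraph) cas_awalk_verts_of_seq:
  assumes "\<And>j. j < length p \<Longrightarrow> tail G (p ! j) = q j \<and> head G (p ! j) = q (Suc j)"
  shows "cas (q 0) p (q (length p)) \<and> awalk_verts (q 0) p = map q [0..<Suc (length p)]"
  using assms
proof (induction p arbitrary: q)
  case (Cons e p)
  have "cas (q (Suc 0)) p (q (Suc (length p))) \<and>
      awalk_verts (q (Suc 0)) p = map (\<lambda>j. q (Suc j)) [0..<Suc (length p)]"
    using Cons.IH[of "\<lambda>j. q (Suc j)"] Cons.prems by fastforce
  moreover have "tail G e = q 0" "head G e = q (Suc 0)" using Cons.prems[of 0] by auto
  ultimately show ?case by (simp add: upt_conv_Cons map_Suc_upt[symmetric] del: upt_Suc)
qed simp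

lemma directed_odd_cycle_no_kernel:
  assumes "directed_odd_cycle H"
  shows "\<not> kernel H S"
proof -
  interpret pre_digraph H .
  obtain p u where p: "awalk u p u" "distinct (tl (awalk_verts u p))" "p \<noteq> []" "odd (length p)"
    "arcs H = set p" "verts H = tail H ` set p"
    using assms unfolding directed_odd_cycle_def cycle_def by blast
  define l where "l = length p"
  define q where "q j = awalk_verts u p ! min j l" for j
  have cas: "cas u p u" using p(1) unfolding awalk_def by blast
  have q: "tail H (p ! j) = q j" "head H (p ! j) = q (Suc j)" if "j < l" for j
    using awalk_verts_nth[OF cas] that unfolding q_def l_def by (auto simp: min_def)
  have len: "length (awalk_verts u p) = Suc l" unfolding l_def by (rule length_awalk_verts)
  have q0: "q 0 = u" and ql: "q l = u"
    using cas_endpoints[OF cas] len unfolding q_def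
    by (simp_all add: hd_conv_nth last_conv_nth)
  have inj: "i = j" if ij: "i < l" "j < l" "q i = q j" for i j
  proof -
    \<comment> \<open>A closed walk lists its first vertex twice, so distinctness concerns the
      indices 1 to \<open>l\<close>; index 0 is traded for \<open>l\<close> afterwards.\<close>
    have inj': "i' = j'" if "1 \<le> i'" "i' \<le> l" "1 \<le> j'" "j' \<le> l" "q i' = q j'" for i' j'
    proof -
      have "tl (awalk_verts u p) ! (i' - 1) = tl (awalk_verts u p) ! (j' - 1)"
        using that len unfolding q_def by (simp add: nth_tl)
      then have "i' - 1 = j' - 1" using p(2) that len by (subst (asm) nth_eq_iff_index_eq) auto
      then show ?thesis using that by simp
    qed
    show ?thesis
      using inj'[of i j] inj'[of l j] inj'[of i l] ij q0 ql by (cases "i = 0"; cases "j = 0") auto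
  qed
  have "\<not> kernel_on (dominates H) (verts H) S"
  proof (rule odd_cycle_no_kernel)
    show "odd l" using p(4) unfolding l_def .
    show "q l = q 0" using q0 ql by simp
    have tailq: "q j \<in> verts H" if "j < l" for j
      using nth_mem[OF that[unfolded l_def]] unfolding p(6) q(1)[OF that, symmetric] by blast
    show "q j \<in> verts H" for j
    proof (cases "j < l")
      case False
      then have "q j = q l" unfolding q_def by simp
      then show ?thesis using tailq[of 0] q0 ql p(3) unfolding l_def by simp
    qed (rule tailq)
    show "q j \<rightarrow>\<^bsub>H\<^esub> q (Suc j)" if "j < l" for j
      using q[OF that] that p(5) unfolding dominates_iff l_def by (metis nth_mem)
    show "y = q (Suc j)" if j: "j < l" and "y \<in> verts H" and arc: "q j \<rightarrow>\<^bsub>H\<^esub> y" for j y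
    proof -
      \<comment> \<open>All arcs of \<open>H\<close> are on the cycle, and by injectivity one that
        leaves \<open>q j\<close> is the arc at position \<open>j\<close>.\<close>
      obtain i where i: "i < l" "tail H (p ! i) = q j" "head H (p ! i) = y"
        using arc p(5) unfolding dominates_iff l_def by (metis in_set_conv_nth)
      then show ?thesis using inj[of i j] q[OF i(1)] j by metis
    qed
  qed
  then show ?thesis unfolding kernel_iff_kernel_on .
qed

section \<open>Isomorphism with circulants\<close>

lemma digraph_iso_dominates:
  assumes "digraph_iso G H"
  obtains h where "bij_betw h (verts G) (verts H)"
    "\<And>x y. \<lbrakk>x \<in> verts G; y \<in> verts G\<rbrakk> \<Longrightarrow> x \<rightarrow>\<^bsub>G\<^esub> y \<longleftrightarrow> h x \<rightarrow>\<^bsub>H\<^esub> h y"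
proof -
  obtain f where f: "pre_digraph.digraph_isomorphism G f" and H: "H = app_iso f G"
    using assms unfolding digraph_iso_def by blast
  interpret wf_digraph G using f unfolding pre_digraph.digraph_isomorphism_def by blast
  have inj: "inj_on (iso_verts f) (verts G)" using f by (rule digraph_isomorphism_inj_on_verts)
  have "bij_betw (iso_verts f) (verts G) (verts H)" unfolding H bij_betw_def using inj by simp
  moreover have "x \<rightarrow>\<^bsub>G\<^esub> y \<longleftrightarrow> iso_verts f x \<rightarrow>\<^bsub>H\<^esub> iso_verts f y" if "x \<in> verts G" "y \<in> verts G" for x y
  proof -
    have "iso_verts f x \<rightarrow>\<^bsub>H\<^esub> iso_verts f y \<longleftrightarrow>
        (\<exists>a\<in>arcs G. iso_verts f (tail G a) = iso_verts f x \<and> iso_verts f (head G a) = iso_verts f y)"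
      unfolding dominates_iff H using iso_verts_tail[OF f] iso_verts_head[OF f] by auto
    also have "\<dots> \<longleftrightarrow> (\<exists>a\<in>arcs G. tail G a = x \<and> head G a = y)"
      using that inj_on_eq_iff[OF inj] by (metis head_in_verts tail_in_verts)
    finally show ?thesis unfolding dominates_iff by simp
  qed
  ultimately show thesis using that by blast
qed

text \<open>The common shape of the two kinds of forbidden circulants: modulo \<open>n\<close> their
  jumps are 1, ..., \<open>r\<close>.\<close>

definition jumps_upto :: "nat \<Rightarrow> int set \<Rightarrow> nat \<Rightarrow> bool" where
  "jumps_upto n J r \<longleftrightarrow> (\<forall>d. (\<exists>k\<in>J. [d = k] (mod int n)) \<longleftrightarrow> d mod int n \<in> {1..int r})"

lemma jumps_upto_7: "jumps_upto 7 {1, 2} 2"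
  unfolding jumps_upto_def cong_def by auto

text \<open>The positive jumps give the residues up to n/2, the negative ones those from n/2 to
  \<open>n - 2\<close>; among the nonzero residues only -1 is missing.\<close>

lemma jumps_upto_one_pm:
  assumes "n \<ge> 4"
  shows "jumps_upto n (one_pm_jumps n) (n - 2)"
  unfolding jumps_upto_def
proof
  fix d :: int
  define e where "e = d mod int n"
  have e: "0 \<le> e" "e < int n" unfolding e_def using assms by simp_all
  have half: "\<lfloor>real n / 2\<rfloor> = int (n div 2)" using floor_divide_of_nat_eq[of n 2] by simp
  have cong: "[d = k] (mod int n) \<longleftrightarrow> e = k mod int n" for k unfolding cong_def e_def ..
  show "(\<exists>k\<in>one_pm_jumps n. [d = k] (mod int n)) \<longleftrightarrow> d mod int n \<in> {1..int (n - 2)}"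
  proof
    assume "\<exists>k\<in>one_pm_jumps n. [d = k] (mod int n)"
    then consider "e = 1 mod int n" | k where "2 \<le> k" "2 * k \<le> int n" "e = k mod int n \<or> e = (- k) mod int n"
      unfolding one_pm_jumps_def half cong by auto
    then have "1 \<le> e \<and> e \<le> int n - 2"
    proof cases
      case 1
      then show ?thesis using assms by simp
    next
      case (2 k)
      have "(- k) mod int n = int n - k"
        using 2 assms by (simp add: zmod_zminus1_eq_if)
      then show ?thesis using 2 assms by auto
    qed
    then show "d mod int n \<in> {1..int (n - 2)}" using assms unfolding e_def by auto
  next
    assume "d mod int n \<in> {1..int (n - 2)}"
    then have er: "1 \<le> e" "e \<le> int n - 2" using assms unfolding e_def by auto
    consider "e = 1" | "2 \<le> e" "2 * e \<le> int n" | "2 * e > int n" using er by linarith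
    then show "\<exists>k\<in>one_pm_jumps n. [d = k] (mod int n)"
    proof cases
      case 1
      then show ?thesis unfolding one_pm_jumps_def cong using assms by (intro bexI[of _ 1]) auto
    next
      case 2
      then show ?thesis unfolding one_pm_jumps_def cong half using er by (intro bexI[of _ e]) auto
    next
      case 3
      have "(- (int n - e)) mod int n = e" using er by simp
      moreover have "int n - e \<in> {2..int (n div 2)}" using er 3 by auto
      then have "- (int n - e) \<in> one_pm_jumps n" unfolding one_pm_jumps_def half by blast
      ultimately show ?thesis unfolding cong by metis
    qed
  qed
qed

lemma circulant_arcs:
  assumes "jumps_upto n J r" "i \<in> {0..<int n}" "j \<in> {0..<int n}"
  shows "(i, j) \<in> parcs (circulant n J) \<longleftrightarrow> (j - i) mod int n \<in> {1..int r}"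
  using assms unfolding circulant_def jumps_upto_def by simp

lemma circulant_iso_no_kernel:
  assumes iso: "digraph_iso H (with_proj (circulant n J))" and J: "jumps_upto n J r"
    and n: "r \<ge> 1" "n = (r + 1) * m + 1" "m \<ge> 1"
  shows "\<not> kernel H S"
proof -
  obtain h where h: "bij_betw h (verts H) {0..<int n}"
    "\<And>x y. \<lbrakk>x \<in> verts H; y \<in> verts H\<rbrakk> \<Longrightarrow> x \<rightarrow>\<^bsub>H\<^esub> y \<longleftrightarrow> (h x, h y) \<in> parcs (circulant n J)"
    using digraph_iso_dominates[OF iso] by (auto simp: circulant_def)
  define g where "g = the_inv_into (verts H) h"
  have g: "bij_betw g {0..<int n} (verts H)" unfolding g_def by (rule bij_betw_the_inv_into[OF h(1)])
  have hg: "h (g i) = i" if "i \<in> {0..<int n}" for i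
    using f_the_inv_into_f_bij_betw[OF h(1)] that unfolding g_def by blast
  define p where "p i = g (i mod int n)" for i
  have "n > 0" using n(2) by simp
  then have rng: "i mod int n \<in> {0..<int n}" for i by simp
  have "circular (dominates H) (verts H) n r p"
    unfolding circular_def
  proof (intro conjI allI)
    show "range p = verts H"
    proof (intro equalityI subsetI)
      fix x assume "x \<in> range p"
      then obtain i where "x = g (i mod int n)" unfolding p_def by blast
      then show "x \<in> verts H" using bij_betw_apply[OF g rng] by simp
    next
      fix x assume x: "x \<in> verts H"
      then have "h x \<in> {0..<int n}" by (rule bij_betw_apply[OF h(1)])
      then have "h x mod int n = h x" by simp
      moreover have "g (h x) = x"
        unfolding g_def by (rule the_inv_into_f_f[OF bij_betw_imp_inj_on[OF h(1)] x])
      ultimately show "x \<in> range p" unfolding p_def by (intro image_eqI[of _ _ "h x"]) simp_all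
    qed
    show "p a = p b \<longleftrightarrow> a mod int n = b mod int n" for a b
    proof
      assume "p a = p b"
      then have "h (g (a mod int n)) = h (g (b mod int n))" unfolding p_def by (rule arg_cong)
      then show "a mod int n = b mod int n" unfolding hg[OF rng] .
    qed (simp add: p_def)
    show "p a \<rightarrow>\<^bsub>H\<^esub> p b \<longleftrightarrow> (b - a) mod int n \<in> {1..int r}" for a b
    proof -
      have "p a \<in> verts H" "p b \<in> verts H" unfolding p_def using bij_betw_apply[OF g rng] by auto
      then have "p a \<rightarrow>\<^bsub>H\<^esub> p b \<longleftrightarrow> (h (p a), h (p b)) \<in> parcs (circulant n J)" by (rule h(2))
      then have "p a \<rightarrow>\<^bsub>H\<^esub> p b \<longleftrightarrow> (a mod int n, b mod int n) \<in> parcs (circulant n J)"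
        unfolding p_def hg[OF rng] .
      then show ?thesis unfolding circulant_arcs[OF J rng rng] mod_diff_eq .
    qed
  qed
  then show ?thesis unfolding kernel_iff_kernel_on by (rule circular_no_kernel[OF _ n])
qed

lemma circular_iso_circulant:
  assumes "digraph D" and W: "W \<subseteq> verts D" and circ: "circular (dominates D) W n r p"
    and n: "n > 0" and J: "jumps_upto n J r"
  shows "digraph_iso (D \<restriction> W) (with_proj (circulant n J))"
proof -
  interpret digraph D by fact
  have rng: "range p = W" and eq: "\<And>a b. p a = p b \<longleftrightarrow> a mod int n = b mod int n"
    and E: "\<And>a b. p a \<rightarrow>\<^bsub>D\<^esub> p b \<longleftrightarrow> (b - a) mod int n \<in> {1..int r}"
    using circ unfolding circular_def by auto
  have pmod: "p (i mod int n) = p i" for i unfolding eq by simp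
  have bij: "bij_betw p {0..<int n} W"
    unfolding bij_betw_def
  proof
    show "inj_on p {0..<int n}" by (rule inj_onI) (simp add: eq)
    have "p i \<in> p ` {0..<int n}" for i using pmod[of i] n by (metis atLeastLessThan_iff imageI of_nat_0_less_iff pos_mod_bound pos_mod_sign)
    then show "p ` {0..<int n} = W" using rng by blast
  qed
  define h where "h = the_inv_into {0..<int n} p"
  have h: "bij_betw h W {0..<int n}" unfolding h_def by (rule bij_betw_the_inv_into[OF bij])
  have ph: "p (h x) = x" if "x \<in> W" for x
    using f_the_inv_into_f_bij_betw[OF bij] that unfolding h_def by blast
  have hrange: "h x \<in> {0..<int n}" if "x \<in> W" for x by (rule bij_betw_apply[OF h that])
  have arc: "(h x, h y) \<in> parcs (circulant n J) \<longleftrightarrow> x \<rightarrow>\<^bsub>D\<^esub> y" if "x \<in> W" "y \<in> W" for x y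
    using circulant_arcs[OF J hrange hrange, OF that] E[of "h x" "h y"] ph that by simp
  \<comment> \<open>An arc goes to the pair of labels of its ends, the form in which
    \<open>circulant\<close> stores arcs. This is injective because \<open>D\<close> has no parallel
    arcs.\<close>
  define f where "f = \<lparr>iso_verts = h, iso_arcs = (\<lambda>a. (h (tail D a), h (head D a))),
    iso_head = snd, iso_tail = fst\<rparr>"
  have hinj: "h x = h y \<longleftrightarrow> x = y" if "x \<in> W" "y \<in> W" for x y
    using ph that by metis
  have "pre_digraph.digraph_isomorphism (D \<restriction> W) f"
    unfolding pre_digraph.digraph_isomorphism_def
  proof (intro conjI)
    show "wf_digraph (D \<restriction> W)" by (rule wellformed_induce_subgraph)
    show "inj_on (iso_verts f) (verts (D \<restriction> W))"
      using bij_betw_imp_inj_on[OF h] unfolding f_def by simp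
    show "inj_on (iso_arcs f) (arcs (D \<restriction> W))"
      using hinj no_multi_arcs unfolding f_def by (auto intro!: inj_onI simp: arc_to_ends_def)
  qed (auto simp: f_def)
  moreover have "with_proj (circulant n J) = app_iso f (D \<restriction> W)"
  proof -
    have "parcs (circulant n J) = (\<lambda>a. (h (tail D a), h (head D a))) ` arcs (D \<restriction> W)" (is "_ = ?R")
    proof (intro equalityI subsetI)
      fix z assume z: "z \<in> parcs (circulant n J)"
      then have "fst z \<in> h ` W" "snd z \<in> h ` W"
        using bij_betw_imp_surj_on[OF h] unfolding circulant_def by auto
      then obtain x y where xy: "x \<in> W" "y \<in> W" "z = (h x, h y)" by (metis imageE prod.collapse)
      then have "x \<rightarrow>\<^bsub>D\<^esub> y" using arc z by simp
      then show "z \<in> ?R" using xy unfolding dominates_iff by auto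
    next
      fix z assume "z \<in> ?R"
      then obtain a where "a \<in> arcs D" "tail D a \<in> W" "head D a \<in> W" "z = (h (tail D a), h (head D a))"
        by auto
      then show "z \<in> parcs (circulant n J)" using arc unfolding dominates_iff by auto
    qed
    moreover have "pverts (circulant n J) = h ` W"
      using bij_betw_imp_surj_on[OF h] unfolding circulant_def by simp
    ultimately show ?thesis unfolding with_proj_def app_iso_def f_def by simp
  qed
  ultimately show ?thesis unfolding digraph_iso_def by blast
qed

lemma circular_directed_odd_cycle:
  assumes "digraph D" and W: "W \<subseteq> verts D" and circ: "circular (dominates D) W n 1 p"
    and n: "odd n" "n > 1"
  shows "directed_odd_cycle (D \<restriction> W)"
proof -
  interpret digraph D by fact
  interpret H: pre_digraph "D \<restriction> W" .
  have rng: "range p = W" and eq: "\<And>a b. p a = p b \<longleftrightarrow> a mod int n = b mod int n"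
    and E: "\<And>a b. p a \<rightarrow>\<^bsub>D\<^esub> p b \<longleftrightarrow> (b - a) mod int n = 1"
    using circ unfolding circular_def by auto
  have pW: "p i \<in> W" for i using rng by blast
  have "\<exists>a. a \<in> arcs D \<and> tail D a = p i \<and> head D a = p (i + 1)" for i
    using E[of i "i + 1"] n unfolding dominates_iff by auto
  then obtain a where a: "\<And>i. a i \<in> arcs D" "\<And>i. tail D (a i) = p i" "\<And>i. head D (a i) = p (i + 1)"
    by metis
  define c where "c = map (\<lambda>i. a (int i)) [0..<n]"
  define q where "q i = p (int i)" for i
  have len: "length c = n" unfolding c_def by simp
  have walk: "H.cas (q 0) c (q n) \<and> H.awalk_verts (q 0) c = map q [0..<Suc n]"
    using H.cas_awalk_verts_of_seq[of c q] len a unfolding c_def q_def by (simp add: add.commute del: upt_Suc)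
  have qn: "q n = q 0" unfolding q_def eq by simp
  have arcs: "arcs (D \<restriction> W) = set c"
  proof (intro equalityI subsetI)
    fix e assume "e \<in> arcs (D \<restriction> W)"
    then have e: "e \<in> arcs D" "tail D e \<in> W" "head D e \<in> W" by auto
    obtain x y where xy: "tail D e = p x" "head D e = p y" using e rng by blast
    then have "p x \<rightarrow>\<^bsub>D\<^esub> p y" using e(1) unfolding dominates_iff by metis
    then have "(y - x) mod int n = 1" using E by simp
    define i where "i = nat (x mod int n)"
    have i: "i < n" "int i = x mod int n" unfolding i_def using n by (auto simp: nat_less_iff)
    have "p x = p (int i)" unfolding eq i by simp
    moreover have "p y = p (int i + 1)"
    proof -
      have "(int i + 1) mod int n = (x + (y - x) mod int n) mod int n"
        unfolding i \<open>(y - x) mod int n = 1\<close> by (simp add: mod_simps)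
      then show ?thesis unfolding eq by (simp add: mod_simps)
    qed
    ultimately have "e = a (int i)"
      using no_multi_arcs[OF e(1) a(1)[of "int i"]] a xy by (simp add: arc_to_ends_def)
    then show "e \<in> set c" unfolding c_def using i(1) by simp
  qed (use a pW in \<open>auto simp: c_def\<close>)
  have "W = tail (D \<restriction> W) ` set c"
  proof (intro equalityI subsetI)
    fix v assume "v \<in> W"
    then obtain x where x: "v = p x" using rng by blast
    define i where "i = nat (x mod int n)"
    have i: "i < n" "v = p (int i)" unfolding i_def x eq using n by (auto simp: nat_less_iff)
    then have "v = tail (D \<restriction> W) (a (int i))" using a(2) by simp
    moreover have "a (int i) \<in> set c" unfolding c_def using i(1) by simp
    ultimately show "v \<in> tail (D \<restriction> W) ` set c" by blast
  qed (use a pW in \<open>auto simp: c_def\<close>)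
  moreover have "H.cycle c"
    unfolding H.cycle_def H.awalk_def
  proof (intro exI[of _ "q 0"] conjI)
    show "q 0 \<in> verts (D \<restriction> W)" unfolding q_def using pW by simp
    show "set c \<subseteq> arcs (D \<restriction> W)" using arcs by simp
    show "H.cas (q 0) c (q 0)" using walk qn by simp
    \<comment> \<open>The tail of the vertex list drops \<open>q 0\<close>, which equals
      \<open>q n\<close>, leaving the labels 1 to \<open>n\<close>.\<close>
    have "inj_on q {1..<Suc n}"
    proof (rule linorder_inj_onI)
      fix i j assume ij: "i < j" "i \<in> {1..<Suc n}" "j \<in> {1..<Suc n}"
      show "q i \<noteq> q j"
      proof
        assume "q i = q j"
        then have "int n dvd int j - int i" unfolding q_def eq by (metis mod_eq_dvd_iff)
        then show False using ij by (auto dest: zdvd_imp_le)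
      qed
    qed auto
    then show "distinct (tl (H.awalk_verts (q 0) c))"
      unfolding conjunct2[OF walk] by (simp add: distinct_map upt_conv_Cons del: upt_Suc)
    show "c \<noteq> []" using len n by auto
  qed
  ultimately show ?thesis
    unfolding directed_odd_cycle_def using arcs len n by (intro exI[of _ c]) simp
qed

theorem theorem8:
  fixes D :: "('a,'b) pre_digraph"
  assumes "digraph D"
    and "locally_in_semicomplete D \<or> locally_out_semicomplete D \<or> locally_semicomplete D"
  shows "KP_digraph D \<longleftrightarrow>
    \<not> (\<exists>H. induced_subgraph H D \<and>
        (directed_odd_cycle H \<or>
         digraph_iso H (with_proj (circulant 7 {1, 2})) \<or>
         (\<exists>n\<ge>4. digraph_iso H (with_proj (circulant n (one_pm_jumps n))))))"
    (is "_ \<longleftrightarrow> \<not> (\<exists>H. induced_subgraph H D \<and> ?bad H)")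
proof -
  interpret digraph D by fact
  let ?E = "dominates D"
  have bad: "\<not> kernel H S" if "?bad H" for H S
    using that
  proof (elim disjE exE conjE)
    assume "directed_odd_cycle H"
    then show ?thesis by (rule directed_odd_cycle_no_kernel)
  next
    assume "digraph_iso H (with_proj (circulant 7 {1, 2}))"
    \<comment> \<open>Here \<open>r = 2\<close> and \<open>m = 2\<close>, as 7 = 3 * 2 + 1.\<close>
    then show ?thesis by (rule circulant_iso_no_kernel[OF _ jumps_upto_7, of _ 2]) simp_all
  next
    fix n :: nat assume n: "n \<ge> 4" "digraph_iso H (with_proj (circulant n (one_pm_jumps n)))"
    show ?thesis
      \<comment> \<open>Here \<open>r = n - 2\<close> and \<open>m = 1\<close>.\<close>
      by (rule circulant_iso_no_kernel[OF n(2) jumps_upto_one_pm[OF n(1)], of 1]) (use n(1) in simp_all)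
  qed
  have "\<exists>H. induced_subgraph H D \<and> ?bad H" if "\<not> KP_digraph D"
  proof -
    let ?P = "\<lambda>X. X \<subseteq> verts D \<and> (\<nexists>S. kernel_on ?E X S)"
    have "\<exists>U. ?P U" using that KP_digraph_iff[OF wf_digraph] by simp
    then obtain U where U: "?P U" ..
    \<comment> \<open>Least cardinality gives every proper subset a kernel, so \<open>W\<close> is
      critical.\<close>
    obtain W where W: "W \<subseteq> verts D" "\<nexists>S. kernel_on ?E W S"
      and min: "\<And>X. \<lbrakk>X \<subseteq> verts D; \<nexists>S. kernel_on ?E X S\<rbrakk> \<Longrightarrow> card W \<le> card X"
      using ex_has_least_nat[of ?P U card, OF U] by metis
    have fin: "finite W" using W(1) finite_verts finite_subset by blast
    have crit: "critical ?E W"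
      unfolding critical_def
    proof (intro conjI allI impI)
      show "\<exists>S. kernel_on ?E X S" if "X \<subset> W" for X
        using min[of X] psubset_card_mono[OF fin that] that W(1) by fastforce
    qed (use fin W in auto)
    have irrefl: "\<not> x \<rightarrow>\<^bsub>D\<^esub> x" for x using no_loops unfolding dominates_iff by metis
    have "locally_in_semicomplete D \<or> locally_out_semicomplete D"
      using assms(2) unfolding locally_semicomplete_def by blast
    then have semi: "(\<forall>x\<in>W. \<forall>y\<in>W. \<forall>z\<in>W. x \<rightarrow>\<^bsub>D\<^esub> z \<and> y \<rightarrow>\<^bsub>D\<^esub> z \<and> x \<noteq> y \<longrightarrow> x \<rightarrow>\<^bsub>D\<^esub> y \<or> y \<rightarrow>\<^bsub>D\<^esub> x) \<or>
      (\<forall>x\<in>W. \<forall>y\<in>W. \<forall>z\<in>W. z \<rightarrow>\<^bsub>D\<^esub> x \<and> z \<rightarrow>\<^bsub>D\<^esub> y \<and> x \<noteq> y \<longrightarrow> x \<rightarrow>\<^bsub>D\<^esub> y \<or> y \<rightarrow>\<^bsub>D\<^esub> x)"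
      using W(1) unfolding locally_in_semicomplete_def locally_out_semicomplete_def semicomplete_def
        in_neighbourhood_def out_neighbourhood_def dominates_induce_subgraph_iff by auto
    obtain n r m p where r: "r \<ge> 1" and m: "m \<ge> 1" and n: "n = (r + 1) * m + 1"
      and circ: "circular ?E W n r p" and cases: "r = 1 \<or> m = 1 \<or> r = 2 \<and> m = 2"
      using critical_circular[OF crit irrefl semi] .
    have "n > 0" using n by simp
    note iso = circular_iso_circulant[OF \<open>digraph D\<close> W(1) circ \<open>n > 0\<close>]
    have "?bad (D \<restriction> W)"
    proof (cases "r = 1")
      case True
      then show ?thesis
        using circular_directed_odd_cycle[OF \<open>digraph D\<close> W(1), of n p] circ n m by simp
    next
      case False
      show ?thesis
      proof (cases "m = 1")
        case True
        \<comment> \<open>With \<open>m = 1\<close> the order is \<open>n = r + 2\<close>, and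
          \<open>r \<ge> 2\<close> since \<open>r = 1\<close> was the odd cycle case.\<close>
        then have "n \<ge> 4" "r = n - 2" using n r False by auto
        then show ?thesis using iso[of "one_pm_jumps n"] jumps_upto_one_pm by blast
      next
        case False
        then have "r = 2" "n = 7" using cases \<open>r \<noteq> 1\<close> n by auto
        then show ?thesis using iso[of "{1, 2}"] jumps_upto_7 by simp
      qed
    qed
    then show ?thesis using induced_induce[OF W(1)] by blast
  qed
  then show ?thesis using bad unfolding KP_digraph_def by blast
qed

end
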